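(* Fix integers $k,l\geq 1$. Let $T$ and $U$ be tableaux with entries from $[k]$ whose shapes occupy at most $l$ columns, and let $T^C,U^C$ be their complements with respect to $k$ and $l$. Then (i) $U$ is Knuth-equivalent to $T$ if and only if $U^C$ is Knuth-equivalent to $T^C$; and (ii) $U$ is dual-equivalent to $T$ if and only if $U^C$ is dual-equivalent to $T^C$.
   Context: A partition is a weakly decreasing sequence of nonnegative integers indexed by an interval of integers (trailing zeros ignored), ordered componentwise by $\subseteq$. A skew shape $\beta/\alpha$ ($\alpha\subseteq\beta$) is a horizontal strip if it has at most one box in each column. A tableau of shape $\beta/\alpha$ with entries from $[k]$ is a chain $\alpha=\beta^0\subseteq\cdots\subseteq\beta^k=\beta$ with each $\beta^i/\beta^{i-1}$ a horizontal strip (equivalently a column-strict filling, the boxes of $\beta^i/\beta^{i-1}$ holding $i$). Tableaux differing only by a vertical shift are identified. $(l^i,\gamma)$ denotes $\gamma$ with $i$ initial parts equal to $l$ prepended. The complement of $T:\beta^0\subseteq\cdots\subseteq\beta^k$ with respect to $k,l$ ($l$ at least the largest part of $\beta^k$) is $T^C:\beta^k\subseteq(l,\beta^{k-1})\subseteq\cdots\subseteq(l^k,\beta^0)$. A jeu de taquin slide into an inner corner (a box adjacent to the shape from the upper left whose addition keeps a skew shape) moves the empty box repeatedly, interchanging it with its right or lower neighbour so that rows stay weakly increasing and columns strictly increasing (when both neighbours exist it exchanges with the smaller, and with the lower one in case of equality), until it has no such neighbours; the reverse procedure is also a jeu de taquin slide. Two tableaux are Knuth-equivalent if one can be obtained from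 the other by a sequence of jeu de taquin slides. Two tableaux of the same shape are dual-equivalent if applying any same sequence of jeu de taquin slides (i.e. slides at the same cells) to both always yields tableaux of the same shape. *)

theory Defs
  imports Main
begin

text \<open>
  Partitions are functions on row indices starting at 0, with finite support, so trailing zeros are
  invisible and \<open>\<subseteq>\<close> is the pointwise order.  Starting every index interval at 0 picks
  one representative from each class of tableaux under vertical shift.
\<close>

type_synonym part = "nat \<Rightarrow> nat"
type_synonym cell = "nat \<times> nat"
type_synonym tableau = "part list"

definition is_partition :: "part \<Rightarrow> bool" where
  "is_partition p \<longleftrightarrow> antimono p \<and> finite {r. p r \<noteq> 0}"

text \<open>Cells are pairs (row, column), both counted from 0.\<close>

definition diagram :: "part \<Rightarrow> cell set" where
  "diagram p = {(r, c). c < p r}"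

definition horizontal_strip :: "part \<Rightarrow> part \<Rightarrow> bool" where
  "horizontal_strip \<beta> \<alpha> \<longleftrightarrow>
     \<alpha> \<le> \<beta> \<and>
     (\<forall>r r' c. (r, c) \<in> diagram \<beta> - diagram \<alpha> \<and> (r', c) \<in> diagram \<beta> - diagram \<alpha> \<longrightarrow> r = r')"

definition is_tableau :: "nat \<Rightarrow> tableau \<Rightarrow> bool" where
  "is_tableau k T \<longleftrightarrow>
     length T = Suc k \<and> (\<forall>p \<in> set T. is_partition p) \<and>
     (\<forall>i<k. horizontal_strip (T ! Suc i) (T ! i))"

text \<open>
  A skew shape is the pair of its two partitions and not merely the set of its boxes: the complement
  below depends on the pair.
\<close>

definition shape :: "tableau \<Rightarrow> part \<times> part" where
  "shape T = (hd T, last T)"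

definition prepend :: "nat \<Rightarrow> nat \<Rightarrow> part \<Rightarrow> part" where
  "prepend i l \<gamma> = (\<lambda>r. if r < i then l else \<gamma> (r - i))"

definition complement :: "nat \<Rightarrow> nat \<Rightarrow> tableau \<Rightarrow> tableau" where
  "complement k l T = map (\<lambda>i. prepend i l (T ! (k - i))) [0..<Suc k]"

definition filling :: "tableau \<Rightarrow> cell \<Rightarrow> nat option" where
  "filling T b =
     (if b \<in> diagram (last T) - diagram (hd T) then Some (LEAST i. b \<in> diagram (T ! i)) else None)"

text \<open>
  \<open>jdt_moves F e F' e'\<close>: starting from the filling \<open>F\<close> with the empty box at \<open>e\<close>, the empty box
  travels right and down until it stops at \<open>e'\<close>, leaving the filling \<open>F'\<close>.
\<close>

inductive jdt_moves ::
  "(cell \<Rightarrow> nat option) \<Rightarrow> cell \<Rightarrow> (cell \<Rightarrow> nat option) \<Rightarrow> cell \<Rightarrow> bool" where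
  stop: "F (r, Suc c) = None \<Longrightarrow> F (Suc r, c) = None \<Longrightarrow> jdt_moves F (r, c) F (r, c)"
| down: "F (Suc r, c) = Some d \<Longrightarrow> (\<And>x. F (r, Suc c) = Some x \<Longrightarrow> d \<le> x) \<Longrightarrow>
    jdt_moves (F((r, c) := Some d, (Suc r, c) := None)) (Suc r, c) F' e' \<Longrightarrow>
    jdt_moves F (r, c) F' e'"
| right: "F (r, Suc c) = Some x \<Longrightarrow> (\<And>d. F (Suc r, c) = Some d \<Longrightarrow> x < d) \<Longrightarrow>
    jdt_moves (F((r, c) := Some x, (r, Suc c) := None)) (r, Suc c) F' e' \<Longrightarrow>
    jdt_moves F (r, c) F' e'"

text \<open>
  Every corner of the inner partition counts as an inner corner, also when the box to its right and
  the box below it are both missing from the shape (which needs an empty row).  The slide then moves no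
  entry and only changes the pair of partitions presenting the set of boxes.
\<close>

definition inner_corner :: "cell \<Rightarrow> tableau \<Rightarrow> bool" where
  "inner_corner b T \<longleftrightarrow>
     b \<in> diagram (hd T) \<and> (\<exists>p. is_partition p \<and> diagram p = diagram (hd T) - {b})"

text \<open>\<open>slide_into k b T S b'\<close>: sliding \<open>T\<close> into its inner corner \<open>b\<close> yields \<open>S\<close> and vacates \<open>b'\<close>.\<close>

definition slide_into :: "nat \<Rightarrow> cell \<Rightarrow> tableau \<Rightarrow> tableau \<Rightarrow> cell \<Rightarrow> bool" where
  "slide_into k b T S b' \<longleftrightarrow>
     is_tableau k T \<and> is_tableau k S \<and> inner_corner b T \<and>
     jdt_moves (filling T) b (filling S) b' \<and>
     diagram (hd S) = diagram (hd T) - {b} \<and>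
     diagram (last S) = diagram (last T) - {b'}"

text \<open>
  A slide starting at the cell \<open>b\<close> is either a slide into the inner corner \<open>b\<close>, or the reversal of a
  slide that vacates \<open>b\<close>.  In the first case \<open>b\<close> lies in the inner partition of \<open>T\<close>, in the second
  outside its outer partition, so the cell alone determines the direction.
\<close>

definition jdt_slide :: "nat \<Rightarrow> cell \<Rightarrow> tableau \<Rightarrow> tableau \<Rightarrow> bool" where
  "jdt_slide k b T S \<longleftrightarrow> (\<exists>b'. slide_into k b T S b') \<or> (\<exists>b'. slide_into k b' S T b)"

fun jdt_slides :: "nat \<Rightarrow> cell list \<Rightarrow> tableau \<Rightarrow> tableau \<Rightarrow> bool" where
  "jdt_slides k [] T S \<longleftrightarrow> S = T"
| "jdt_slides k (b # bs) T S \<longleftrightarrow> (\<exists>R. jdt_slide k b T R \<and> jdt_slides k bs R S)"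

definition knuth_equivalent :: "nat \<Rightarrow> tableau \<Rightarrow> tableau \<Rightarrow> bool" where
  "knuth_equivalent k T U \<longleftrightarrow> (\<exists>bs. jdt_slides k bs T U)"

definition dual_equivalent :: "nat \<Rightarrow> tableau \<Rightarrow> tableau \<Rightarrow> bool" where
  "dual_equivalent k T U \<longleftrightarrow>
     shape T = shape U \<and>
     (\<forall>bs T' U'. jdt_slides k bs T T' \<and> jdt_slides k bs U U' \<longrightarrow> shape T' = shape U')"

end

theory Submission imports Defs begin

text \<open>
  The complement of a jeu de taquin slide is in general not a slide of the complement, so the theorem is
  reached through the crystal (coplactic) operators instead: the one at level \<open>i\<close> changes a single
  entry \<open>i + 1\<close> into \<open>i\<close>, that is, it adds a box to the partition \<open>T ! i\<close> and keeps the others.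
  These operators commute with slides and, after replacing \<open>i\<close> by \<open>k - i\<close>, also with
  complementation.  A tableau of straight shape on which no operator is defined is determined by its
  shape, and also by its content.  Hence two tableaux are Knuth-equivalent iff they have the same content and
  the same sequences of operators are defined on them, and they are dual-equivalent iff operators can
  carry both to a common tableau.  Complementation preserves both conditions.
\<close>

section \<open>Interlacing partitions\<close>

text \<open>A slide keeps the content and changes the shape; an operator keeps the shape and changes
  the content. Since they commute, slides reach straight shape without altering which operators
  apply, and operators reach a common target without altering where slides start and stop. The way
  back exists because both moves are injective: the operator at a given level, and the slide once
  its vacated cell is known. The path of a slide through the boxes is hard to compare before and
  after one entry changes, so a slide is recorded by the row in which each \<open>T ! i\<close>
  loses a box. Each next row depends only on two consecutive partitions. An operator touches one
  partition, so it interferes with only two consecutive steps, and commutation becomes a case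
  distinction on three partitions. These three also explain the symmetry under complement: up to a
  shift of rows, the outer two enter in the same way into the quantity that governs the
  operator.\<close>

definition interlace :: "part \<Rightarrow> part \<Rightarrow> bool" where
  "interlace \<alpha> \<beta> \<longleftrightarrow> (\<forall>r. \<alpha> r \<le> \<beta> r \<and> \<beta> (Suc r) \<le> \<alpha> r)"

lemma interlaceD:
  assumes "interlace \<alpha> \<beta>"
  shows "\<alpha> r \<le> \<beta> r" "\<beta> (Suc r) \<le> \<alpha> r"
  using assms by (auto simp: interlace_def)

lemma partition_Suc_le: "is_partition p \<Longrightarrow> p (Suc r) \<le> p r"
  by (simp add: is_partition_def antimonoD)

lemma is_partitionI:
  assumes "\<And>r. p (Suc r) \<le> p r" "finite {r. p r \<noteq> 0}"
  shows "is_partition p"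
  using assms by (auto simp: is_partition_def antimono_iff_le_Suc)

text \<open>If \<open>\<beta> (Suc r) \<le> \<alpha> r\<close> fails, rows \<open>r\<close> and
  \<open>Suc r\<close> both have a strip box in column \<open>\<alpha> r\<close>. If it holds, all
  lower rows end before the strip begins in row \<open>r\<close>.\<close>

lemma horizontal_strip_iff_interlace:
  assumes "is_partition \<alpha>" "is_partition \<beta>"
  shows "horizontal_strip \<beta> \<alpha> \<longleftrightarrow> interlace \<alpha> \<beta>"
proof
  assume h: "horizontal_strip \<beta> \<alpha>"
  show "interlace \<alpha> \<beta>"
    unfolding interlace_def
  proof (intro allI conjI)
    fix r
    show "\<alpha> r \<le> \<beta> r"
      using h by (simp add: horizontal_strip_def le_fun_def)
    show "\<beta> (Suc r) \<le> \<alpha> r"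
    proof (rule ccontr)
      assume "\<not> \<beta> (Suc r) \<le> \<alpha> r"
      then have "(r, \<alpha> r) \<in> diagram \<beta> - diagram \<alpha>" "(Suc r, \<alpha> r) \<in> diagram \<beta> - diagram \<alpha>"
        using partition_Suc_le[OF assms(1), of r] partition_Suc_le[OF assms(2), of r]
        by (auto simp: diagram_def)
      then have "r = Suc r"
        using h unfolding horizontal_strip_def by blast
      then show False by simp
    qed
  qed
next
  assume i: "interlace \<alpha> \<beta>"
  have no_pair: False
    if "r < r'" "(r, c) \<in> diagram \<beta> - diagram \<alpha>" "(r', c) \<in> diagram \<beta> - diagram \<alpha>" for r r' c
  proof -
    have "\<beta> r' \<le> \<beta> (Suc r)"
      using assms(2) that(1) by (simp add: is_partition_def antimonoD)
    also have "\<dots> \<le> \<alpha> r"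
      using i by (rule interlaceD)
    finally show False
      using that by (auto simp: diagram_def)
  qed
  show "horizontal_strip \<beta> \<alpha>"
    unfolding horizontal_strip_def le_fun_def
    using i no_pair by (metis interlaceD(1) linorder_neqE_nat)
qed

lemma is_tableau_iff:
  "is_tableau k T \<longleftrightarrow> length T = Suc k \<and> (\<forall>i\<le>k. is_partition (T ! i)) \<and>
     (\<forall>i<k. interlace (T ! i) (T ! Suc i))"
proof -
  have "(\<forall>p \<in> set T. is_partition p) \<longleftrightarrow> (\<forall>i\<le>k. is_partition (T ! i))" if "length T = Suc k"
    using that by (auto simp: all_set_conv_all_nth less_Suc_eq_le)
  then show ?thesis
    unfolding is_tableau_def
    by (metis Suc_leI horizontal_strip_iff_interlace less_imp_le_nat)
qed

lemma is_tableauD: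
  assumes "is_tableau k T"
  shows "length T = Suc k" "hd T = T ! 0" "last T = T ! k"
    "\<And>i. i \<le> k \<Longrightarrow> is_partition (T ! i)"
    "\<And>i r. i < k \<Longrightarrow> (T ! i) r \<le> (T ! Suc i) r"
    "\<And>i r. i < k \<Longrightarrow> (T ! Suc i) (Suc r) \<le> (T ! i) r"
proof -
  have t: "length T = Suc k" "\<forall>i\<le>k. is_partition (T ! i)" "\<forall>i<k. interlace (T ! i) (T ! Suc i)"
    using assms by (simp_all add: is_tableau_iff)
  show "length T = Suc k" by (fact t(1))
  show "hd T = T ! 0" "last T = T ! k"
    using t(1) by (cases T, simp_all) (metis diff_Suc_1 last_conv_nth length_0_conv nat.distinct(1))
  show "\<And>i. i \<le> k \<Longrightarrow> is_partition (T ! i)"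
    using t(2) by simp
  show "\<And>i r. i < k \<Longrightarrow> (T ! i) r \<le> (T ! Suc i) r"
    "\<And>i r. i < k \<Longrightarrow> (T ! Suc i) (Suc r) \<le> (T ! i) r"
    using t(3) interlaceD by blast+
qed

lemma tableau_mono:
  assumes "is_tableau k T" "i \<le> j" "j \<le> k"
  shows "(T ! i) r \<le> (T ! j) r"
  using assms(2,3)
proof (induction j rule: dec_induct)
  case (step j)
  then show ?case
    using is_tableauD(5)[OF assms(1), of j r] by simp
qed simp

lemma shape_tableau: "is_tableau k T \<Longrightarrow> shape T = (T ! 0, T ! k)"
  by (simp add: shape_def is_tableauD)

lemma diagram_inject: "diagram p = diagram q \<longleftrightarrow> p = q"
proof
  assume h: "diagram p = diagram q"
  show "p = q"
  proof
    fix r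
    have "c < p r \<longleftrightarrow> c < q r" for c
      using h by (auto simp: diagram_def set_eq_iff)
    then show "p r = q r"
      by (metis linorder_neqE_nat less_irrefl)
  qed
qed simp

definition lower :: "nat \<Rightarrow> part \<Rightarrow> part" where
  "lower r p = p(r := p r - 1)"

lemma lower_apply: "lower r p s = (if s = r then p r - 1 else p s)"
  by (simp add: lower_def)

lemma diagram_lower: "0 < p r \<Longrightarrow> diagram (lower r p) = diagram p - {(r, p r - 1)}"
  by (auto simp: diagram_def lower_apply split: if_splits)

lemma finite_support_upd:
  assumes "finite {s. p s \<noteq> (0::nat)}"
  shows "finite {s. (p(r := x)) s \<noteq> 0}"
  by (rule finite_subset[of _ "insert r {s. p s \<noteq> 0}"]) (use assms in auto)

lemma is_partition_lower:
  assumes "is_partition p" "p (Suc r) < p r"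
  shows "is_partition (lower r p)"
proof (rule is_partitionI)
  show "finite {s. lower r p s \<noteq> 0}"
    unfolding lower_def using assms(1) by (intro finite_support_upd) (simp add: is_partition_def)
  show "lower r p (Suc s) \<le> lower r p s" for s
    using partition_Suc_le[OF assms(1), of s] assms(2) by (auto simp: lower_apply)
qed

section \<open>Slides as sequences of rows\<close>

text \<open>
  While a slide passes the entry \<open>i\<close>, the empty box moves to the end of its row in \<open>T ! i\<close>, unless
  the box below it holds \<open>i\<close>; then it drops by one row.  So \<open>T ! i\<close> loses the last box of row \<open>\<rho> i\<close>.
\<close>

definition slide_rows :: "nat \<Rightarrow> tableau \<Rightarrow> tableau \<Rightarrow> (nat \<Rightarrow> nat) \<Rightarrow> bool" where
  "slide_rows k T S \<rho> \<longleftrightarrow>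
     is_tableau k T \<and> length S = Suc k \<and> (T ! 0) (Suc (\<rho> 0)) < (T ! 0) (\<rho> 0) \<and>
     (\<forall>i<k. \<rho> (Suc i) = (if (T ! Suc i) (Suc (\<rho> i)) = (T ! i) (\<rho> i) then Suc (\<rho> i) else \<rho> i)) \<and>
     (\<forall>i\<le>k. S ! i = lower (\<rho> i) (T ! i))"

lemma slide_rowsD:
  assumes "slide_rows k T S \<rho>"
  shows "is_tableau k T" "length S = Suc k" "(T ! 0) (Suc (\<rho> 0)) < (T ! 0) (\<rho> 0)"
    "\<And>i. i < k \<Longrightarrow> \<rho> (Suc i) = (if (T ! Suc i) (Suc (\<rho> i)) = (T ! i) (\<rho> i) then Suc (\<rho> i) else \<rho> i)"
    "\<And>i. i \<le> k \<Longrightarrow> S ! i = lower (\<rho> i) (T ! i)"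
  using assms by (auto simp: slide_rows_def)

text \<open>Every row of the path ends in a removable box. With q = \<open>\<rho> i\<close>, staying
  gives \<open>(T ! Suc i) (Suc q) < (T ! i) q \<le> (T ! Suc i) q\<close>, and dropping gives
  \<open>(T ! Suc i) (Suc (Suc q)) \<le> (T ! i) (Suc q) < (T ! i) q = (T ! Suc i) (Suc
  q)\<close>.\<close>

lemma slide_rows_corner:
  assumes "slide_rows k T S \<rho>" "i \<le> k"
  shows "(T ! i) (Suc (\<rho> i)) < (T ! i) (\<rho> i)"
  using assms(2)
proof (induction i)
  case 0
  then show ?case using slide_rowsD(3)[OF assms(1)] by simp
next
  case (Suc i)
  note T = slide_rowsD(1)[OF assms(1)]
  have i: "i < k" using Suc.prems by simp
  have IH: "(T ! i) (Suc (\<rho> i)) < (T ! i) (\<rho> i)"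
    using Suc by simp
  note ineqs = is_tableauD(5)[OF T i, of "\<rho> i"] is_tableauD(6)[OF T i, of "\<rho> i"]
    is_tableauD(6)[OF T i, of "Suc (\<rho> i)"]
  show ?case
    using slide_rowsD(4)[OF assms(1) i] IH ineqs by (auto split: if_splits)
qed

lemma slide_rows_tableau:
  assumes "slide_rows k T S \<rho>"
  shows "is_tableau k S"
  unfolding is_tableau_iff
proof (intro conjI allI impI)
  note T = slide_rowsD(1)[OF assms] and S = slide_rowsD(5)[OF assms]
  show "length S = Suc k" using slide_rowsD(2)[OF assms] .
  show "is_partition (S ! i)" if "i \<le> k" for i
    using is_partition_lower[OF is_tableauD(4)[OF T that] slide_rows_corner[OF assms that]]
    by (simp add: S that)
  show "interlace (S ! i) (S ! Suc i)" if i: "i < k" for i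
    unfolding interlace_def
  proof
    fix r
    have "S ! i = lower (\<rho> i) (T ! i)" "S ! Suc i = lower (\<rho> (Suc i)) (T ! Suc i)"
      using S i by simp_all
    then show "(S ! i) r \<le> (S ! Suc i) r \<and> (S ! Suc i) (Suc r) \<le> (S ! i) r"
      using slide_rows_corner[OF assms, of i] slide_rowsD(4)[OF assms i] i
        is_tableauD(5)[OF T i, of r] is_tableauD(6)[OF T i, of r]
      by (auto simp: lower_apply split: if_splits)
  qed
qed

lemma slide_rows_exists:
  assumes "is_tableau k T" "(T ! 0) (Suc r) < (T ! 0) r"
  obtains S \<rho> where "slide_rows k T S \<rho>" "\<rho> 0 = r"
proof -
  define \<rho> where
    "\<rho> = rec_nat r (\<lambda>i q. if (T ! Suc i) (Suc q) = (T ! i) q then Suc q else q)"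
  define S where "S = map (\<lambda>i. lower (\<rho> i) (T ! i)) [0..<Suc k]"
  have "slide_rows k T S \<rho>"
    using assms by (auto simp: slide_rows_def S_def \<rho>_def simp del: upt_Suc)
  then show thesis
    by (rule that) (simp add: \<rho>_def)
qed

lemma slide_rows_unique:
  assumes "slide_rows k T S \<rho>" "slide_rows k T S' \<rho>'" "\<rho> 0 = \<rho>' 0"
  shows "S = S'"
proof -
  have rows: "\<rho> i = \<rho>' i" if "i \<le> k" for i
    using that
  proof (induction i)
    case (Suc i)
    then show ?case
      using slide_rowsD(4)[OF assms(1), of i] slide_rowsD(4)[OF assms(2), of i] by simp
  qed (simp add: assms(3))
  show "S = S'"
  proof (rule nth_equalityI)
    show "length S = length S'"
      using slide_rowsD(2)[OF assms(1)] slide_rowsD(2)[OF assms(2)] by simp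
    show "S ! i = S' ! i" if "i < length S" for i
      using that slide_rowsD(2)[OF assms(1)] slide_rowsD(5)[OF assms(1), of i]
        slide_rowsD(5)[OF assms(2), of i] rows[of i] by simp
  qed
qed

lemma lower_eq_imp:
  assumes "lower r p = lower r q" "0 < p r" "0 < q r"
  shows "p = q"
proof
  fix s
  show "p s = q s"
    using fun_cong[OF assms(1), of s] assms(2,3) by (auto simp: lower_apply split: if_splits)
qed

lemma slide_rows_reverse_unique:
  assumes s: "slide_rows k T S \<rho>" and s': "slide_rows k T' S \<rho>'" and "\<rho> k = \<rho>' k"
  shows "T = T'"
proof -
  note T = slide_rowsD(1)[OF s] and T' = slide_rowsD(1)[OF s']
  \<comment> \<open>Paths that merge at \<open>Suc i\<close> would have one dropping from a row q
    and the other staying in \<open>Suc q\<close>. Level \<open>i\<close> of \<open>S\<close> then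
    gives \<open>(T' ! i) q = (T ! i) q - 1\<close>, while level \<open>Suc i\<close> gives
    \<open>(T' ! Suc i) (Suc q) = (T ! i) q\<close>, which is too long for interlacing in
    \<open>T'\<close>.\<close>
  have no_clash: False
    if s: "slide_rows k T S \<rho>" and s': "slide_rows k T' S \<rho>'" and i: "i < k"
      and eq: "\<rho> (Suc i) = \<rho>' (Suc i)" and less: "\<rho> i < \<rho>' i" for T T' \<rho> \<rho>' i
  proof -
    note T' = slide_rowsD(1)[OF s']
    have rows: "\<rho> (Suc i) = Suc (\<rho> i)" "\<rho>' (Suc i) = Suc (\<rho> i)" "\<rho>' i = Suc (\<rho> i)"
      using slide_rowsD(4)[OF s i] slide_rowsD(4)[OF s' i] eq less by (auto split: if_splits)
    have drop: "(T ! Suc i) (Suc (\<rho> i)) = (T ! i) (\<rho> i)"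
      using slide_rowsD(4)[OF s i] rows by (auto split: if_splits)
    have "lower (\<rho> i) (T ! i) = lower (Suc (\<rho> i)) (T' ! i)"
      "lower (Suc (\<rho> i)) (T ! Suc i) = lower (Suc (\<rho> i)) (T' ! Suc i)"
      using slide_rowsD(5)[OF s, of i] slide_rowsD(5)[OF s', of i]
        slide_rowsD(5)[OF s, of "Suc i"] slide_rowsD(5)[OF s', of "Suc i"] i rows by simp_all
    note this[THEN fun_cong, of "\<rho> i"] this[THEN fun_cong, of "Suc (\<rho> i)"]
    then show False
      using drop slide_rows_corner[OF s, of i] slide_rows_corner[OF s', of "Suc i"]
        slide_rows_corner[OF s, of "Suc i"] i rows is_tableauD(6)[OF T' i, of "\<rho> i"]
      by (simp add: lower_apply)
  qed
  have rows: "\<rho> i = \<rho>' i" if "i \<le> k" for i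
    using that
  proof (induction i rule: inc_induct)
    case (step i)
    then show ?case
      using no_clash[OF s s', of i] no_clash[OF s' s, of i] by (metis linorder_neqE_nat)
  qed (simp add: assms(3))
  show ?thesis
  proof (rule nth_equalityI)
    show "length T = length T'"
      using is_tableauD(1)[OF T] is_tableauD(1)[OF T'] by simp
    fix i assume "i < length T"
    then have i: "i \<le> k" using is_tableauD(1)[OF T] by simp
    show "T ! i = T' ! i"
      using lower_eq_imp[of "\<rho> i" "T ! i" "T' ! i"] slide_rowsD(5)[OF s i] slide_rowsD(5)[OF s' i]
        rows[OF i] slide_rows_corner[OF s i] slide_rows_corner[OF s' i] by simp
  qed
qed

section \<open>Jeu de taquin slides are row sequences\<close>

lemma filling_eq_Some_iff:
  assumes "is_tableau k T"
  shows "filling T (r, c) = Some v \<longleftrightarrow> 0 < v \<and> v \<le> k \<and> (T ! (v - 1)) r \<le> c \<and> c < (T ! v) r"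
proof
  note T = is_tableauD[OF assms] and mono = tableau_mono[OF assms]
  assume "filling T (r, c) = Some v"
  then have c: "c < (T ! k) r" "\<not> c < (T ! 0) r" and v: "v = (LEAST i. c < (T ! i) r)"
    by (auto simp: filling_def T diagram_def split: if_splits)
  have "c < (T ! v) r" "v \<le> k"
    unfolding v using c(1) by (auto intro: LeastI Least_le)
  moreover have "0 < v"
    using c(2) \<open>c < (T ! v) r\<close> by (metis gr0I)
  moreover have "\<not> c < (T ! (v - 1)) r"
    using not_less_Least[of "v - 1" "\<lambda>i. c < (T ! i) r"] \<open>0 < v\<close> v by auto
  ultimately show "0 < v \<and> v \<le> k \<and> (T ! (v - 1)) r \<le> c \<and> c < (T ! v) r"
    by simp
next
  note T = is_tableauD[OF assms] and mono = tableau_mono[OF assms]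
  assume h: "0 < v \<and> v \<le> k \<and> (T ! (v - 1)) r \<le> c \<and> c < (T ! v) r"
  have "c < (T ! k) r" "\<not> c < (T ! 0) r"
    using h mono[of v k r] mono[of 0 "v - 1" r] diff_le_self[of v 1] le_trans[of "v - 1" v k] by auto
  moreover have "(LEAST i. c < (T ! i) r) = v"
  proof (rule Least_equality)
    show "v \<le> i" if "c < (T ! i) r" for i
      using that h mono[of i "v - 1" r] le_trans[of "v - 1" v k] by (cases "i \<le> v - 1") auto
  qed (use h in simp)
  ultimately show "filling T (r, c) = Some v"
    by (auto simp: filling_def T diagram_def)
qed

lemma filling_eq_SomeI:
  assumes "is_tableau k T" "i < k" "(T ! i) r \<le> c" "c < (T ! Suc i) r"
  shows "filling T (r, c) = Some (Suc i)"
  using assms by (simp add: filling_eq_Some_iff[OF assms(1)])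

lemma filling_eq_None_inner: "is_tableau k T \<Longrightarrow> c < (T ! 0) r \<Longrightarrow> filling T (r, c) = None"
  by (simp add: filling_def is_tableauD diagram_def)

lemma filling_eq_None_outer: "is_tableau k T \<Longrightarrow> (T ! k) r \<le> c \<Longrightarrow> filling T (r, c) = None"
  by (auto simp: filling_def is_tableauD diagram_def)

lemma filling_Some_gt:
  assumes "is_tableau k T" "(T ! i) r \<le> c" "filling T (r, c) = Some v" "i \<le> k"
  shows "i < v"
proof (rule ccontr)
  assume "\<not> i < v"
  then have "(T ! v) r \<le> (T ! i) r"
    using tableau_mono[OF assms(1), of v i r] assms(4) by simp
  then show False
    using assms(2,3) by (simp add: filling_eq_Some_iff[OF assms(1)])
qed

text \<open>A filling does not reveal the inner partition in rows without boxes, hence the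
  hypothesis on \<open>T ! 0\<close>. From there, each level extends the previous one by the boxes
  holding \<open>Suc i\<close>.\<close>

lemma filling_inject:
  assumes T: "is_tableau k T" and S: "is_tableau k S" and "filling T = filling S" "T ! 0 = S ! 0"
  shows "T = S"
proof (rule nth_equalityI)
  show "length T = length S"
    using is_tableauD(1)[OF T] is_tableauD(1)[OF S] by simp
  fix i assume "i < length T"
  then have "i \<le> k"
    using is_tableauD(1)[OF T] by simp
  then show "T ! i = S ! i"
  proof (induction i)
    case (Suc i)
    then have i: "i < k" and IH: "T ! i = S ! i" by simp_all
    have le: "(A ! Suc i) r \<le> (B ! Suc i) r"
      if A: "is_tableau k A" and B: "is_tableau k B" and "filling A = filling B" "A ! i = B ! i"
      for A B r
    proof (rule ccontr)
      let ?c = "(B ! Suc i) r"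
      assume "\<not> ?thesis"
      then have "filling A (r, ?c) = Some (Suc i)"
        using is_tableauD(5)[OF B i, of r] that by (intro filling_eq_SomeI[OF A i]) auto
      then show False
        using that by (simp add: filling_eq_Some_iff[OF B])
    qed
    show ?case
      using le[OF T S] le[OF S T] assms(3) IH by (intro ext antisym) auto
  qed (use assms in simp)
qed

lemma jdt_moves_unique:
  assumes "jdt_moves F e F1 e1" "jdt_moves F e F2 e2"
  shows "F1 = F2 \<and> e1 = e2"
  using assms
proof (induction arbitrary: F2 e2 rule: jdt_moves.induct)
  case (stop F r c)
  from stop(3) show ?case
    by cases (use stop(1,2) in auto)
next
  case (down F r c d F' e')
  note IH = down.IH
  from down.prems show ?case
  proof cases
    case (down d')
    have "d' = d" using down(1) \<open>F (Suc r, c) = Some d\<close> by simp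
    then show ?thesis using IH down by blast
  qed (use down.hyps(1,2) in force)+
next
  case (right F r c x F' e')
  note IH = right.IH
  from right.prems show ?case
  proof cases
    case (right x')
    have "x' = x" using right(1) \<open>F (r, Suc c) = Some x\<close> by simp
    then show ?thesis using IH right by blast
  qed (use right.hyps(1,2) in force)+
qed

text \<open>The filling in the middle of a slide, when exactly the entries up to \<open>i\<close> have been passed.\<close>

definition mixed_filling :: "tableau \<Rightarrow> tableau \<Rightarrow> nat \<Rightarrow> cell \<Rightarrow> nat option" where
  "mixed_filling T S i = (\<lambda>(r, c). if c < (S ! i) r then filling S (r, c)
     else if c < (T ! i) r then None else filling T (r, c))"

lemma slide_rows_cases:
  assumes "slide_rows k T S \<rho>" "i < k"
  obtains (stay) "\<rho> (Suc i) = \<rho> i" "(T ! Suc i) (Suc (\<rho> i)) < (T ! i) (\<rho> i)"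
    | (drop) "\<rho> (Suc i) = Suc (\<rho> i)" "(T ! Suc i) (Suc (\<rho> i)) = (T ! i) (\<rho> i)"
  using slide_rowsD(4)[OF assms] is_tableauD(6)[OF slide_rowsD(1)[OF assms(1)] assms(2), of "\<rho> i"]
  by (auto split: if_splits)

lemma jdt_moves_mixed_step:
  assumes s: "slide_rows k T S \<rho>" and i: "i < k"
    and moves: "jdt_moves (mixed_filling T S (Suc i)) (\<rho> (Suc i), (T ! Suc i) (\<rho> (Suc i)) - 1) F' e'"
  shows "jdt_moves (mixed_filling T S i) (\<rho> i, (T ! i) (\<rho> i) - 1) F' e'"
proof -
  note T = slide_rowsD(1)[OF s] and S = slide_rows_tableau[OF s]
  define q where "q = \<rho> i"
  define c where "c = (T ! i) q - 1"
  let ?F = "mixed_filling T S i"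
  have Ti: "(T ! i) q = Suc c" "(T ! i) (Suc q) \<le> c"
    using slide_rows_corner[OF s, of i] i by (simp_all add: q_def c_def)
  have Si: "S ! i = lower q (T ! i)" and Ssi: "S ! Suc i = lower (\<rho> (Suc i)) (T ! Suc i)"
    using slide_rowsD(5)[OF s] i by (simp_all add: q_def)
  have new_T: "filling T (r, x) = Some (Suc i)" if "(T ! i) r \<le> x" "x < (T ! Suc i) r" for r x
    using that by (rule filling_eq_SomeI[OF T i])
  have new_S: "filling S (r, x) = Some (Suc i)" if "(S ! i) r \<le> x" "x < (S ! Suc i) r" for r x
    using that by (rule filling_eq_SomeI[OF S i])
  have T_le: "(T ! i) r \<le> (T ! Suc i) r" for r
    by (rule is_tableauD(5)[OF T i])
  from s i show ?thesis
  proof (cases rule: slide_rows_cases)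
    case stay
    \<comment> \<open>\<open>n\<close> counts the entries \<open>Suc i\<close> in row
      \<open>q\<close>, which fill columns \<open>Suc c\<close> to \<open>c + n\<close>;
      \<open>G j\<close> is the filling after \<open>j\<close> of them have shifted left. The
      induction below runs from \<open>G n\<close> back to \<open>G 0\<close>, since
      \<open>jdt_moves\<close> is built up from its final position.\<close>
    define n where "n = (T ! Suc i) q - (T ! i) q"
    define G where "G j = (\<lambda>(r, x). if r = q \<and> c \<le> x \<and> x < c + j then Some (Suc i)
      else if r = q \<and> x = c + j then None else ?F (r, x))" for j
    have Tsi: "(T ! Suc i) q = Suc (c + n)"
      using T_le[of q] Ti(1) by (simp add: n_def)
    have "mixed_filling T S (Suc i) = G n"
    proof
      fix y :: cell
      obtain r x where y: "y = (r, x)" by fastforce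
      show "mixed_filling T S (Suc i) y = G n y"
        unfolding y G_def mixed_filling_def prod.case
        using Ti Tsi stay(1) T_le[of r] new_T[of r x] new_S[of r x]
        by (auto simp: Si Ssi lower_apply q_def[symmetric] split: if_splits)
    qed
    then have "jdt_moves (G n) (q, c + n) F' e'"
      using moves stay Tsi by (simp add: q_def)
    then have "jdt_moves (G (n - j)) (q, c + (n - j)) F' e'" if "j \<le> n" for j
      using that
    proof (induction j)
      case (Suc j)
      define m where "m = n - Suc j"
      have m: "m < n" "n - j = Suc m"
        using Suc.prems by (simp_all add: m_def)
      have right: "G m (q, Suc (c + m)) = Some (Suc i)"
        using Ti Tsi m(1) new_T[of q "Suc (c + m)"]
        by (simp add: G_def mixed_filling_def Si lower_apply)
      \<comment> \<open>Staying means that row \<open>Suc q\<close> of \<open>T ! Suc i\<close> does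
        not reach column \<open>c\<close>, so whatever lies below the empty box exceeds
        \<open>Suc i\<close>.\<close>
      have below: "Suc i < d" if "G m (Suc q, c + m) = Some d" for d
      proof (rule filling_Some_gt[OF T])
        show "(T ! Suc i) (Suc q) \<le> c + m"
          using stay(2) Ti by (simp add: q_def[symmetric])
        show "filling T (Suc q, c + m) = Some d"
          using that Ti by (simp add: G_def mixed_filling_def Si lower_apply)
      qed (use i in simp)
      have "(G m)((q, c + m) := Some (Suc i), (q, Suc (c + m)) := None) = G (Suc m)"
        by (auto simp: G_def fun_eq_iff)
      then have "jdt_moves ((G m)((q, c + m) := Some (Suc i), (q, Suc (c + m)) := None))
          (q, Suc (c + m)) F' e'"
        using Suc m by simp
      then have "jdt_moves (G m) (q, c + m) F' e'"
        using jdt_moves.right[of "G m" q "c + m" "Suc i" F' e'] right below by blast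
      then show ?case by (simp add: m_def)
    qed simp
    from this[of n] have "jdt_moves (G 0) (q, c) F' e'" by simp
    moreover have "G 0 = ?F"
      using Ti by (auto simp: G_def fun_eq_iff mixed_filling_def Si lower_apply)
    ultimately show ?thesis
      using Ti by (simp add: q_def[symmetric])
  next
    case drop
    have Tsi: "(T ! Suc i) (Suc q) = Suc c"
      using drop(2) Ti by (simp add: q_def[symmetric])
    have below: "?F (Suc q, c) = Some (Suc i)"
      using Ti Tsi new_T[of "Suc q" c] by (simp add: mixed_filling_def Si lower_apply)
    \<comment> \<open>The right neighbour lies outside \<open>T ! i\<close>; a tie with the entry
      \<open>Suc i\<close> below goes to the lower neighbour.\<close>
    have right: "Suc i \<le> x" if "?F (q, Suc c) = Some x" for x
      using filling_Some_gt[OF T, of i q "Suc c" x] that Ti i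
      by (simp add: mixed_filling_def Si lower_apply)
    have "?F((q, c) := Some (Suc i), (Suc q, c) := None) = mixed_filling T S (Suc i)"
    proof
      fix y :: cell
      obtain r x where y: "y = (r, x)" by fastforce
      show "(?F((q, c) := Some (Suc i), (Suc q, c) := None)) y = mixed_filling T S (Suc i) y"
        unfolding y mixed_filling_def prod.case fun_upd_apply
        using Ti Tsi drop(1) T_le[of r] new_T[of r x] new_S[of r x]
        by (auto simp: Si Ssi lower_apply q_def[symmetric] split: if_splits)
    qed
    then have "jdt_moves (?F((q, c) := Some (Suc i), (Suc q, c) := None)) (Suc q, c) F' e'"
      using moves drop(1) Tsi by (simp add: q_def[symmetric])
    from jdt_moves.down[OF below right this] show ?thesis
      using Ti by (simp add: q_def[symmetric])
  qed
qed

lemma slide_rows_jdt_moves: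
  assumes s: "slide_rows k T S \<rho>"
  shows "jdt_moves (filling T) (\<rho> 0, (T ! 0) (\<rho> 0) - 1) (filling S) (\<rho> k, (T ! k) (\<rho> k) - 1)"
proof -
  note T = slide_rowsD(1)[OF s] and S = slide_rows_tableau[OF s]
  let ?e = "\<lambda>i. (\<rho> i, (T ! i) (\<rho> i) - 1)"
  have last: "mixed_filling T S k = filling S"
    by (auto simp: mixed_filling_def fun_eq_iff filling_eq_None_outer[OF T] filling_eq_None_outer[OF S])
  have first: "mixed_filling T S 0 = filling T"
    by (auto simp: mixed_filling_def fun_eq_iff filling_eq_None_inner[OF T]
        filling_eq_None_inner[OF S] slide_rowsD(5)[OF s] lower_apply split: if_splits)
  have stop: "jdt_moves (filling S) (?e k) (filling S) (?e k)"
    using slide_rows_corner[OF s, of k]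
    by (intro jdt_moves.stop filling_eq_None_outer[OF S]) (simp_all add: slide_rowsD(5)[OF s] lower_apply)
  have "jdt_moves (mixed_filling T S i) (?e i) (filling S) (?e k)" if "i \<le> k" for i
    using that
  proof (induction i rule: inc_induct)
    case base
    show ?case using stop by (simp add: last)
  next
    case (step i)
    show ?case by (rule jdt_moves_mixed_step[OF s step.hyps(2) step.IH])
  qed
  from this[of 0] show ?thesis by (simp add: first)
qed

lemma inner_cornerE:
  assumes "inner_corner b T"
  obtains r where "b = (r, hd T r - 1)" "hd T (Suc r) < hd T r"
proof -
  obtain r c where b: "b = (r, c)" by fastforce
  obtain p where p: "is_partition p" "diagram p = diagram (hd T) - {b}" and c: "c < hd T r"
    using assms by (auto simp: inner_corner_def b diagram_def)
  have p_iff: "x < p s \<longleftrightarrow> x < hd T s \<and> (s, x) \<noteq> (r, c)" for s x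
    using p(2) by (auto simp: b diagram_def set_eq_iff)
  have "p r \<le> c"
    using p_iff[of c r] by simp
  then have "\<not> c < hd T r - 1"
    using p_iff[of "hd T r - 1" r] c by auto
  moreover have "hd T (Suc r) = p (Suc r)"
    using p_iff[of _ "Suc r"] by (metis Pair_inject linorder_neqE_nat n_not_Suc_n nat_less_le)
  moreover have "p (Suc r) \<le> p r"
    using p(1) by (rule partition_Suc_le)
  ultimately show thesis
    using that[of r] c \<open>p r \<le> c\<close> by (simp add: b)
qed

lemma slide_into_iff_rows:
  "slide_into k b T S b' \<longleftrightarrow>
     (\<exists>\<rho>. slide_rows k T S \<rho> \<and> b = (\<rho> 0, (T ! 0) (\<rho> 0) - 1) \<and> b' = (\<rho> k, (T ! k) (\<rho> k) - 1))"
proof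
  assume h: "slide_into k b T S b'"
  then have T: "is_tableau k T" and S: "is_tableau k S" and corner: "inner_corner b T"
    and moves: "jdt_moves (filling T) b (filling S) b'"
    and inner: "diagram (hd S) = diagram (hd T) - {b}"
    by (simp_all add: slide_into_def)
  obtain r where r: "b = (r, (T ! 0) r - 1)" "(T ! 0) (Suc r) < (T ! 0) r"
    using corner by (auto elim: inner_cornerE simp: is_tableauD(2)[OF T])
  obtain R \<rho> where R: "slide_rows k T R \<rho>" and \<rho>: "\<rho> 0 = r"
    using slide_rows_exists[OF T r(2)] .
  have eq: "filling S = filling R" "b' = (\<rho> k, (T ! k) (\<rho> k) - 1)"
    using jdt_moves_unique[OF moves] slide_rows_jdt_moves[OF R] by (auto simp: \<rho> r(1))
  have "diagram (S ! 0) = diagram (R ! 0)"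
    using inner r by (simp add: is_tableauD(2)[OF T] is_tableauD(2)[OF S] slide_rowsD(5)[OF R] \<rho> diagram_lower)
  then have "S = R"
    by (intro filling_inject[OF S slide_rows_tableau[OF R] eq(1)]) (simp add: diagram_inject)
  then show "\<exists>\<rho>. slide_rows k T S \<rho> \<and> b = (\<rho> 0, (T ! 0) (\<rho> 0) - 1) \<and> b' = (\<rho> k, (T ! k) (\<rho> k) - 1)"
    using R eq(2) \<rho> r(1) by blast
next
  assume "\<exists>\<rho>. slide_rows k T S \<rho> \<and> b = (\<rho> 0, (T ! 0) (\<rho> 0) - 1) \<and> b' = (\<rho> k, (T ! k) (\<rho> k) - 1)"
  then obtain \<rho> where s: "slide_rows k T S \<rho>"
    and b: "b = (\<rho> 0, (T ! 0) (\<rho> 0) - 1)" "b' = (\<rho> k, (T ! k) (\<rho> k) - 1)" by blast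
  note T = slide_rowsD(1)[OF s] and S = slide_rows_tableau[OF s]
  have diagrams: "diagram (S ! 0) = diagram (T ! 0) - {b}" "diagram (S ! k) = diagram (T ! k) - {b'}"
    using slide_rows_corner[OF s, of 0] slide_rows_corner[OF s, of k]
    by (simp_all add: slide_rowsD(5)[OF s] b diagram_lower)
  moreover have "inner_corner b T"
    unfolding inner_corner_def
    using diagrams(1) is_tableauD(4)[OF S, of 0] slide_rowsD(3)[OF s]
    by (auto simp: is_tableauD(2)[OF T] b diagram_def)
  ultimately show "slide_into k b T S b'"
    using T S slide_rows_jdt_moves[OF s]
    by (simp add: slide_into_def is_tableauD(2,3)[OF T] is_tableauD(2,3)[OF S] b)
qed

section \<open>Crystal operators\<close>

text \<open>
  For a skew tableau \<open>\<alpha> \<subseteq> \<beta> \<subseteq> \<gamma>\<close> with entries 1 and 2, read the rows from the top, each row from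
  right to left.  \<open>balance \<alpha> \<beta> \<gamma> r\<close> is the number of 1s minus the number of 2s read up to the last 2
  of row \<open>r\<close>.  The crystal operator turns a 2 into a 1 in the first row where this is minimal, provided
  that the minimum is negative.
\<close>

definition balance :: "part \<Rightarrow> part \<Rightarrow> part \<Rightarrow> nat \<Rightarrow> int" where
  "balance \<alpha> \<beta> \<gamma> r = (\<Sum>s<r. 2 * int (\<beta> s) - int (\<alpha> s) - int (\<gamma> s)) + int (\<beta> r) - int (\<gamma> r)"

lemma balance_0: "balance \<alpha> \<beta> \<gamma> 0 = int (\<beta> 0) - int (\<gamma> 0)"
  by (simp add: balance_def)

lemma balance_Suc:
  "balance \<alpha> \<beta> \<gamma> (Suc r) =
     balance \<alpha> \<beta> \<gamma> r + int (\<beta> r) + int (\<beta> (Suc r)) - int (\<alpha> r) - int (\<gamma> (Suc r))"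
  by (simp add: balance_def)

definition raising_row :: "part \<Rightarrow> part \<Rightarrow> part \<Rightarrow> nat \<Rightarrow> bool" where
  "raising_row \<alpha> \<beta> \<gamma> p \<longleftrightarrow> balance \<alpha> \<beta> \<gamma> p < 0 \<and>
     (\<forall>r. balance \<alpha> \<beta> \<gamma> p \<le> balance \<alpha> \<beta> \<gamma> r) \<and> (\<forall>r<p. balance \<alpha> \<beta> \<gamma> p < balance \<alpha> \<beta> \<gamma> r)"

lemma raising_row_unique:
  assumes "raising_row \<alpha> \<beta> \<gamma> p" "raising_row \<alpha> \<beta> \<gamma> q"
  shows "p = q"
  using assms unfolding raising_row_def by (metis linorder_neqE_nat linorder_not_le)

lemma balance_eventually_constant:
  assumes "is_partition \<alpha>" "is_partition \<beta>" "is_partition \<gamma>"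
  obtains N where "\<And>r. N \<le> r \<Longrightarrow> balance \<alpha> \<beta> \<gamma> r = balance \<alpha> \<beta> \<gamma> N"
proof -
  have "finite ({r. \<alpha> r \<noteq> 0} \<union> {r. \<beta> r \<noteq> 0} \<union> {r. \<gamma> r \<noteq> 0})"
    using assms by (simp add: is_partition_def)
  then obtain N where N: "\<forall>r\<in>{r. \<alpha> r \<noteq> 0} \<union> {r. \<beta> r \<noteq> 0} \<union> {r. \<gamma> r \<noteq> 0}. r < N"
    using finite_nat_set_iff_bounded by blast
  then have z: "\<alpha> r = 0 \<and> \<beta> r = 0 \<and> \<gamma> r = 0" if "N \<le> r" for r
    using that by (metis (mono_tags, lifting) UnCI linorder_not_le mem_Collect_eq)
  have "balance \<alpha> \<beta> \<gamma> r = balance \<alpha> \<beta> \<gamma> N" if "N \<le> r" for r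
    using that
  proof (induction r rule: dec_induct)
    case (step r)
    then show ?case by (simp add: balance_Suc z)
  qed simp
  then show thesis by (rule that)
qed

text \<open>The balance is constant beyond the supports, so its infimum over all rows is attained
  among finitely many; the first minimizer qualifies.\<close>

lemma raising_row_exists:
  assumes "is_partition \<alpha>" "is_partition \<beta>" "is_partition \<gamma>" "balance \<alpha> \<beta> \<gamma> r < 0"
  obtains p where "raising_row \<alpha> \<beta> \<gamma> p"
proof -
  let ?m = "balance \<alpha> \<beta> \<gamma>"
  obtain N where N: "\<And>s. N \<le> s \<Longrightarrow> ?m s = ?m N"
    using balance_eventually_constant[OF assms(1-3)] by metis
  have fin: "finite (?m ` {..N})" by simp
  have min: "Min (?m ` {..N}) \<le> ?m s" for s
    using Min_le[OF fin, of "?m (min s N)"] N[of s] by (cases "N \<le> s") auto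
  define p where "p = (LEAST s. ?m s = Min (?m ` {..N}))"
  have "\<exists>s. ?m s = Min (?m ` {..N})"
    using Min_in[OF fin] by fastforce
  then have p: "?m p = Min (?m ` {..N})"
    unfolding p_def by (rule LeastI_ex)
  have "?m p < ?m s" if "s < p" for s
    using min[of s] not_less_Least[of s "\<lambda>s. ?m s = Min (?m ` {..N})"] that p
    by (fold p_def) linarith
  then have "raising_row \<alpha> \<beta> \<gamma> p"
    using p min assms(4) le_less_trans[OF min[of r] assms(4)] by (simp add: raising_row_def)
  then show thesis by (rule that)
qed

text \<open>For \<open>p = Suc q\<close> the balance changes from \<open>q\<close> to
  \<open>p\<close> by \<open>(\<beta> q - \<alpha> q) + (\<beta> p - \<gamma> p)\<close>, which is
  also \<open>(\<beta> q - \<gamma> p) + (\<beta> p - \<alpha> q)\<close>. Interlacing makes both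
  first brackets nonnegative, so a strict decrease makes both second ones negative: row
  \<open>p\<close> has room for a box.\<close>

lemma raising_row_bounds:
  assumes "interlace \<alpha> \<beta>" "interlace \<beta> \<gamma>" "raising_row \<alpha> \<beta> \<gamma> p"
  shows "\<beta> p < \<gamma> p" "p = Suc q \<Longrightarrow> \<beta> p < \<alpha> q"
proof -
  have step: "\<beta> p < \<gamma> p \<and> \<beta> p < \<alpha> q" if "p = Suc q" for q
  proof -
    have "balance \<alpha> \<beta> \<gamma> p < balance \<alpha> \<beta> \<gamma> q"
      using assms(3) that by (simp add: raising_row_def)
    then show ?thesis
      using interlaceD[OF assms(1), of q] interlaceD[OF assms(2), of q]
      by (simp add: that balance_Suc)
  qed
  then show "p = Suc q \<Longrightarrow> \<beta> p < \<alpha> q" by blast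
  show "\<beta> p < \<gamma> p"
  proof (cases p)
    case 0
    then show ?thesis using assms(3) by (simp add: raising_row_def balance_0)
  next
    case (Suc q)
    then show ?thesis using step by simp
  qed
qed

abbreviation increment :: "nat \<Rightarrow> part \<Rightarrow> part" where
  "increment p \<beta> \<equiv> \<beta>(p := Suc (\<beta> p))"

lemma interlace_increment:
  assumes "interlace \<alpha> \<beta>" "interlace \<beta> \<gamma>" "raising_row \<alpha> \<beta> \<gamma> p"
  shows "interlace \<alpha> (increment p \<beta>)" "interlace (increment p \<beta>) \<gamma>"
  unfolding interlace_def
  using interlaceD[OF assms(1)] interlaceD[OF assms(2)] raising_row_bounds[OF assms]
  by (auto simp: Suc_le_eq le_SucI)

text \<open>The row changed by a crystal operator is recovered as the last one with minimal balance.\<close>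

lemma raising_row_inject:
  assumes "raising_row \<alpha> \<beta> \<gamma> p" "raising_row \<alpha> \<beta>' \<gamma> p'" "increment p \<beta> = increment p' \<beta>'"
  shows "\<beta> = \<beta>'"
proof -
  have int_increment: "int (increment p \<beta> s) = int (\<beta> s) + (if s = p then 1 else 0)" for \<beta> p s
    by simp
  \<comment> \<open>Rows above \<open>p\<close> exceeded the minimum by at least 1 and keep their
    value, row \<open>p\<close> gains 1, and rows below gain 2. So \<open>p\<close> is minimal
    afterwards, and it is the last such row.\<close>
  have balance_increment: "balance \<alpha> (increment p \<beta>) \<gamma> r =
      balance \<alpha> \<beta> \<gamma> r + (if r < p then 0 else if r = p then 1 else 2)" for \<beta> p r
    by (induction r) (auto simp: balance_0 balance_Suc int_increment less_Suc_eq simp del: fun_upd_apply)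
  have no_less: False
    if p: "raising_row \<alpha> \<beta> \<gamma> p" and p': "raising_row \<alpha> \<beta>' \<gamma> p'"
      and eq: "increment p \<beta> = increment p' \<beta>'" and less: "p < p'" for \<beta> \<beta>' p p'
  proof -
    have "balance \<alpha> (increment p \<beta>) \<gamma> p < balance \<alpha> (increment p \<beta>) \<gamma> p'"
      using p less unfolding balance_increment raising_row_def by (auto simp: add.commute add_strict_increasing)
    moreover have "balance \<alpha> (increment p' \<beta>') \<gamma> p' \<le> balance \<alpha> (increment p' \<beta>') \<gamma> p"
      using p' less unfolding balance_increment raising_row_def by (auto simp: add1_zle_eq)
    ultimately show False by (simp add: eq)
  qed
  have "p = p'"
    using no_less assms by (metis linorder_neqE_nat)
  then show ?thesis
    using assms(3) by (metis fun_upd_same fun_upd_triv fun_upd_upd nat.inject)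
qed

section \<open>Commutation of a slide with a two-letter operator\<close>

definition next_row :: "part \<Rightarrow> part \<Rightarrow> nat \<Rightarrow> nat" where
  "next_row \<alpha> \<beta> q = (if \<beta> (Suc q) = \<alpha> q then Suc q else q)"

text \<open>Along a slide, \<open>y\<close> and \<open>z\<close> each exceed their predecessor by at
  most 1, and the corrections nearly cancel. What remains is -1 in row \<open>x\<close> for staying
  then dropping, and +1 in row \<open>Suc x\<close> for dropping then staying.\<close>

lemma balance_lower:
  assumes "0 < \<alpha> x" "0 < \<beta> y" "0 < \<gamma> z"
  shows "balance (lower x \<alpha>) (lower y \<beta>) (lower z \<gamma>) r = balance \<alpha> \<beta> \<gamma> r +
    (if x < r then 1 else 0) - (if y < r then 2 else if y = r then 1 else 0) + (if z \<le> r then 1 else 0)"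
proof -
  have int_lower: "int (lower x p s) = int (p s) - (if s = x then 1 else 0)" if "0 < p x" for x p s
    using that by (auto simp: lower_apply)
  show ?thesis
    by (induction r) (auto simp: balance_0 balance_Suc int_lower assms less_Suc_eq le_Suc_eq)
qed

text \<open>A slide changes the balance only in the row where it stays for one entry and drops for the other.\<close>

lemma slide_commutes_raising:
  assumes i1: "interlace \<alpha> \<beta>" and i2: "interlace \<beta> \<gamma>"
    and x: "\<alpha> (Suc x) < \<alpha> x" and y: "y = next_row \<alpha> \<beta> x" and z: "z = next_row \<beta> \<gamma> y"
    and p: "raising_row \<alpha> \<beta> \<gamma> p"
  defines "\<beta>' \<equiv> increment p \<beta>"
  shows "next_row \<beta>' \<gamma> (next_row \<alpha> \<beta>' x) = z"
    "\<exists>p'. raising_row (lower x \<alpha>) (lower y \<beta>) (lower z \<gamma>) p' \<and>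
       increment p' (lower y \<beta>) = lower (next_row \<alpha> \<beta>' x) \<beta>'"
proof -
  let ?m = "balance \<alpha> \<beta> \<gamma>" and ?n = "balance (lower x \<alpha>) (lower y \<beta>) (lower z \<gamma>)"
  have px: "\<alpha> x \<le> \<beta> x" "\<beta> x \<le> \<gamma> x" "\<beta> (Suc x) \<le> \<alpha> x" "\<gamma> (Suc x) \<le> \<beta> x"
    "\<gamma> (Suc (Suc x)) \<le> \<beta> (Suc x)" "\<beta> (Suc x) \<le> \<gamma> (Suc x)"
    using interlaceD[OF i1] interlaceD[OF i2] by auto
  have min: "?m p < 0" "\<And>r. ?m p \<le> ?m r" "\<And>r. r < p \<Longrightarrow> ?m p < ?m r"
    using p by (auto simp: raising_row_def)
  have step: "?m (Suc x) = ?m x + int (\<beta> x) + int (\<beta> (Suc x)) - int (\<alpha> x) - int (\<gamma> (Suc x))"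
    by (rule balance_Suc)
  have pos: "0 < \<alpha> x" "0 < \<beta> y" "0 < \<gamma> z"
    using x px by (auto simp: y z next_row_def)
  note n = balance_lower[of \<alpha> x \<beta> y \<gamma> z, OF pos]
  \<comment> \<open>The slide stays twice, stays and drops, drops and stays, or drops twice. In each
    case the extra box in row \<open>p\<close> might alter an equality tested by
    \<open>next_row\<close>.\<close>
  consider (A) "\<beta> (Suc x) < \<alpha> x" "\<gamma> (Suc x) < \<beta> x" "y = x" "z = x"
    | (B) "\<beta> (Suc x) < \<alpha> x" "\<gamma> (Suc x) = \<beta> x" "y = x" "z = Suc x"
    | (C) "\<beta> (Suc x) = \<alpha> x" "\<gamma> (Suc (Suc x)) < \<beta> (Suc x)" "y = Suc x" "z = Suc x"
    | (D) "\<beta> (Suc x) = \<alpha> x" "\<gamma> (Suc (Suc x)) = \<beta> (Suc x)" "y = Suc x" "z = Suc (Suc x)"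
    using px y z
    by (cases "\<beta> (Suc x) = \<alpha> x"; cases "\<gamma> (Suc x) = \<beta> x"; cases "\<gamma> (Suc (Suc x)) = \<beta> (Suc x)")
      (auto simp: next_row_def)
  then have "next_row \<beta>' \<gamma> (next_row \<alpha> \<beta>' x) = z \<and>
    (\<exists>p'. raising_row (lower x \<alpha>) (lower y \<beta>) (lower z \<gamma>) p' \<and>
       increment p' (lower y \<beta>) = lower (next_row \<alpha> \<beta>' x) \<beta>')"
  proof cases
    case A
    have "?n = ?m" unfolding fun_eq_iff n using A by auto
    then have "raising_row (lower x \<alpha>) (lower y \<beta>) (lower z \<gamma>) p"
      using p by (simp add: raising_row_def)
    \<comment> \<open>If \<open>p = Suc x\<close>, the strict decrease of the balance from
      \<open>x\<close> to \<open>Suc x\<close> forces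
      \<open>Suc (\<beta> (Suc x)) < \<alpha> x\<close>, so the extra box cannot cause a
      drop.\<close>
    moreover have "\<beta>' (Suc x) \<noteq> \<alpha> x"
      using A step min(3)[of x] by (auto simp: \<beta>'_def)
    then have "next_row \<alpha> \<beta>' x = x" by (simp add: next_row_def)
    moreover have "next_row \<beta>' \<gamma> x = x"
      using A by (auto simp: next_row_def \<beta>'_def)
    moreover have "increment p (lower y \<beta>) = lower x \<beta>'"
      using A pos by (auto simp: \<beta>'_def lower_apply fun_eq_iff)
    ultimately show ?thesis using A by auto
  next
    case B
    have n_eq: "?n r = (if r = x then ?m r - 1 else ?m r)" for r
      unfolding n using B by auto
    have "p \<noteq> x"
      using min(2)[of "Suc x"] step B by auto
    show ?thesis
    proof (cases "p = Suc x \<and> Suc (\<beta> (Suc x)) = \<alpha> x")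
      \<comment> \<open>Here alone the path and the raising row both change. The extra box makes the
        slide drop one entry earlier, and the balance of row \<open>x\<close>, lowered by 1, becomes
        the first minimum; both orders leave the middle partition equal to
        \<open>\<beta>\<close>.\<close>
      case True
      then have mx: "?m x = ?m p + 1" using step B by simp
      have "raising_row (lower x \<alpha>) (lower y \<beta>) (lower z \<gamma>) x"
        unfolding raising_row_def n_eq
        using min mx True by (auto simp: less_Suc_eq)
      moreover have "next_row \<alpha> \<beta>' x = Suc x" "next_row \<beta>' \<gamma> (Suc x) = Suc x"
        using True px by (auto simp: next_row_def \<beta>'_def)
      moreover have "increment x (lower y \<beta>) = lower (Suc x) \<beta>'"
        using B True pos by (auto simp: \<beta>'_def lower_apply fun_eq_iff)
      ultimately show ?thesis using B by auto
    next
      case False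
      have "?m p < ?n x" if "x < p"
      proof (cases "p = Suc x")
        case True
        then show ?thesis unfolding n_eq using False B step by simp
      next
        case False
        then show ?thesis unfolding n_eq using that B step min(3)[of "Suc x"] by simp
      qed
      moreover have "?m p \<le> ?n x"
        unfolding n_eq using min(2)[of "Suc x"] B step by simp
      ultimately have "raising_row (lower x \<alpha>) (lower y \<beta>) (lower z \<gamma>) p"
        using min \<open>p \<noteq> x\<close> by (auto simp: raising_row_def n_eq split: if_splits)
      moreover have "next_row \<alpha> \<beta>' x = x" "next_row \<beta>' \<gamma> x = Suc x"
        using False B \<open>p \<noteq> x\<close> by (auto simp: next_row_def \<beta>'_def)
      moreover have "increment p (lower y \<beta>) = lower x \<beta>'"
        using B \<open>p \<noteq> x\<close> by (auto simp: \<beta>'_def lower_apply fun_eq_iff)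
      ultimately show ?thesis using B by auto
    qed
  next
    case C
    have n_eq: "?n r = (if r = Suc x then ?m r + 1 else ?m r)" for r
      unfolding n using C by auto
    \<comment> \<open>As \<open>\<beta> (Suc x) = \<alpha> x\<close>, the balance does not decrease
      from \<open>x\<close> to \<open>Suc x\<close>, so \<open>Suc x\<close> cannot be a first
      minimum.\<close>
    have "p \<noteq> Suc x"
      using min(3)[of x] step C px by auto
    have "raising_row (lower x \<alpha>) (lower y \<beta>) (lower z \<gamma>) p"
      using min \<open>p \<noteq> Suc x\<close> by (auto simp: raising_row_def n_eq add_strict_increasing add_increasing add.commute)
    moreover have "next_row \<alpha> \<beta>' x = Suc x" "next_row \<beta>' \<gamma> (Suc x) = Suc x"
      using C \<open>p \<noteq> Suc x\<close> by (auto simp: next_row_def \<beta>'_def)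
    moreover have "increment p (lower y \<beta>) = lower (Suc x) \<beta>'"
      using C \<open>p \<noteq> Suc x\<close> by (auto simp: \<beta>'_def lower_apply fun_eq_iff)
    ultimately show ?thesis using C by auto
  next
    case D
    have "?n = ?m" unfolding fun_eq_iff n using D by auto
    then have "raising_row (lower x \<alpha>) (lower y \<beta>) (lower z \<gamma>) p"
      using p by (simp add: raising_row_def)
    moreover have "p \<noteq> Suc x"
      using min(3)[of x] step D px by auto
    then have "next_row \<alpha> \<beta>' x = Suc x" "next_row \<beta>' \<gamma> (Suc x) = Suc (Suc x)"
      using D by (auto simp: next_row_def \<beta>'_def)
    moreover have "increment p (lower y \<beta>) = lower (Suc x) \<beta>'"
      using D \<open>p \<noteq> Suc x\<close> by (auto simp: \<beta>'_def lower_apply fun_eq_iff)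
    ultimately show ?thesis using D by auto
  qed
  then show "next_row \<beta>' \<gamma> (next_row \<alpha> \<beta>' x) = z"
    "\<exists>p'. raising_row (lower x \<alpha>) (lower y \<beta>) (lower z \<gamma>) p' \<and>
       increment p' (lower y \<beta>) = lower (next_row \<alpha> \<beta>' x) \<beta>'" by blast+
qed

text \<open>This yields definedness in the other direction across a slide. The balance drops only in
  row \<open>x\<close>, when the slide stays and then drops; in that case the original balance is
  already negative in row \<open>Suc x\<close>.\<close>

lemma negative_balance_of_lower:
  assumes i1: "interlace \<alpha> \<beta>" and i2: "interlace \<beta> \<gamma>"
    and x: "\<alpha> (Suc x) < \<alpha> x" and y: "y = next_row \<alpha> \<beta> x" and z: "z = next_row \<beta> \<gamma> y"
    and neg: "balance (lower x \<alpha>) (lower y \<beta>) (lower z \<gamma>) r < 0"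
  shows "\<exists>r. balance \<alpha> \<beta> \<gamma> r < 0"
proof -
  have px: "\<alpha> x \<le> \<beta> x" "\<beta> x \<le> \<gamma> x" "\<beta> (Suc x) \<le> \<alpha> x" "\<gamma> (Suc x) \<le> \<beta> x"
    "\<gamma> (Suc (Suc x)) \<le> \<beta> (Suc x)" "\<beta> (Suc x) \<le> \<gamma> (Suc x)"
    using interlaceD[OF i1] interlaceD[OF i2] by auto
  have pos: "0 < \<alpha> x" "0 < \<beta> y" "0 < \<gamma> z"
    using x px by (auto simp: y z next_row_def)
  note n = balance_lower[of \<alpha> x \<beta> y \<gamma> z, OF pos]
  show ?thesis
  proof (cases "y = x \<and> z = Suc x \<and> r = x")
    case True
    then have "\<beta> (Suc x) < \<alpha> x" "\<gamma> (Suc x) = \<beta> x"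
      using px y z by (auto simp: next_row_def split: if_splits)
    then have "balance \<alpha> \<beta> \<gamma> (Suc x) < 0"
      using neg True n[of r] by (auto simp: balance_Suc)
    then show ?thesis by blast
  next
    case False
    then have "balance \<alpha> \<beta> \<gamma> r < 0"
      using neg[unfolded n] y z by (auto simp: next_row_def split: if_splits)
    then show ?thesis by blast
  qed
qed

section \<open>Operators on whole tableaux and their transport along slides\<close>

definition raise :: "nat \<Rightarrow> nat \<Rightarrow> tableau \<Rightarrow> tableau \<Rightarrow> bool" where
  "raise k i T U \<longleftrightarrow> 0 < i \<and> i < k \<and>
     (\<exists>p. raising_row (T ! (i - 1)) (T ! i) (T ! Suc i) p \<and> U = T[i := increment p (T ! i)])"

fun raises :: "nat \<Rightarrow> nat list \<Rightarrow> tableau \<Rightarrow> tableau \<Rightarrow> bool" where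
  "raises k [] T U \<longleftrightarrow> U = T"
| "raises k (i # is) T U \<longleftrightarrow> (\<exists>V. raise k i T V \<and> raises k is V U)"

lemma tableau_interlace:
  assumes "is_tableau k T" "0 < i" "i < k"
  shows "interlace (T ! (i - 1)) (T ! i)" "interlace (T ! i) (T ! Suc i)"
proof -
  have "\<forall>j<k. interlace (T ! j) (T ! Suc j)"
    using assms(1) by (simp add: is_tableau_iff)
  from this[rule_format, of "i - 1"] this[rule_format, of i]
  show "interlace (T ! (i - 1)) (T ! i)" "interlace (T ! i) (T ! Suc i)"
    using assms(2,3) by simp_all
qed

lemma raise_tableau:
  assumes T: "is_tableau k T" and "raise k i T U"
  shows "is_tableau k U"
proof -
  obtain p where i: "0 < i" "i < k" and p: "raising_row (T ! (i - 1)) (T ! i) (T ! Suc i) p"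
    and U: "U = T[i := increment p (T ! i)]"
    using assms(2) by (auto simp: raise_def)
  let ?\<beta> = "increment p (T ! i)"
  note il = interlace_increment[OF tableau_interlace[OF T i] p]
  have part: "is_partition ?\<beta>"
  proof (rule is_partitionI)
    show "?\<beta> (Suc r) \<le> ?\<beta> r" for r
      using interlaceD[OF il(1), of r] by (rule order_trans[rotated])
    show "finite {r. ?\<beta> r \<noteq> 0}"
      using is_tableauD(4)[OF T, of i] i by (intro finite_support_upd) (simp add: is_partition_def)
  qed
  have "interlace (U ! j) (U ! Suc j)" if "j < k" for j
  proof -
    consider "Suc j = i" | "j = i" | "Suc j \<noteq> i" "j \<noteq> i" by blast
    then show ?thesis
    proof cases
      case 1
      then show ?thesis
        using il(1) i is_tableauD(1)[OF T] by (auto simp: U)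
    next
      case 2
      then show ?thesis
        using il(2) i is_tableauD(1)[OF T] by (simp add: U)
    next
      case 3
      then show ?thesis
        using that T by (simp add: U is_tableau_iff)
    qed
  qed
  moreover have "is_partition (U ! j)" if "j \<le> k" for j
    using that part is_tableauD(4)[OF T] is_tableauD(1)[OF T] by (cases "j = i") (simp_all add: U)
  ultimately show ?thesis
    by (simp add: is_tableau_iff U is_tableauD(1)[OF T])
qed

lemma raise_unique: "raise k i T U \<Longrightarrow> raise k i T V \<Longrightarrow> U = V"
  by (auto simp: raise_def dest: raising_row_unique)

lemma raise_inject:
  assumes "is_tableau k T" "is_tableau k T'" "raise k i T U" "raise k i T' U"
  shows "T = T'"
proof -
  obtain p where i: "0 < i" "i < k" and p: "raising_row (T ! (i - 1)) (T ! i) (T ! Suc i) p"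
    and U: "U = T[i := increment p (T ! i)]"
    using assms(3) by (auto simp: raise_def)
  obtain p' where p': "raising_row (T' ! (i - 1)) (T' ! i) (T' ! Suc i) p'"
    and U': "U = T'[i := increment p' (T' ! i)]"
    using assms(4) by (auto simp: raise_def)
  have len: "length T = Suc k" "length T' = Suc k"
    using assms by (auto simp: is_tableauD(1))
  have eq: "T ! j = T' ! j" if "j \<noteq> i" for j
    using U U' that by (metis nth_list_update_neq)
  have "T ! i = T' ! i"
  proof (rule raising_row_inject[OF p])
    show "raising_row (T ! (i - 1)) (T' ! i) (T ! Suc i) p'"
      using p' eq[of "i - 1"] eq[of "Suc i"] i by simp
    show "increment p (T ! i) = increment p' (T' ! i)"
      using U U' len i by (metis less_SucI nth_list_update_eq)
  qed
  then show ?thesis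
    using eq len by (intro nth_equalityI) (auto, metis)
qed

lemma raise_ends:
  assumes "raise k i T U"
  shows "U ! 0 = T ! 0" "U ! k = T ! k"
  using assms by (auto simp: raise_def)

lemma raises_ends: "raises k is T U \<Longrightarrow> U ! 0 = T ! 0 \<and> U ! k = T ! k"
  by (induction "is" arbitrary: T) (auto dest: raise_ends)

lemma raises_tableau: "is_tableau k T \<Longrightarrow> raises k is T U \<Longrightarrow> is_tableau k U"
  by (induction "is" arbitrary: T) (auto dest: raise_tableau)

lemma raises_shape: "is_tableau k T \<Longrightarrow> raises k is T U \<Longrightarrow> shape U = shape T"
  using raises_ends[of k "is" T U] raises_tableau[of k T "is" U] by (simp add: shape_tableau)

lemma raises_inject:
  assumes "is_tableau k T" "is_tableau k T'" "raises k is T U" "raises k is T' U"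
  shows "T = T'"
  using assms
proof (induction "is" arbitrary: T T')
  case (Cons i "is")
  then show ?case by (metis raise_inject raise_tableau raises.simps(2))
qed simp

text \<open>Only level \<open>i\<close> changes, so the path can differ only there: it has rejoined
  the old one at \<open>Suc i\<close>. As \<open>0 < i < k\<close>, its end rows survive, so the
  slide of \<open>U\<close> enters and vacates the same cells.\<close>

lemma raise_slide:
  assumes s: "slide_rows k T S \<rho>" and r: "raise k i T U"
  obtains V \<rho>' where "slide_rows k U V \<rho>'" "raise k i S V" "\<rho>' 0 = \<rho> 0" "\<rho>' k = \<rho> k"
proof -
  note T = slide_rowsD(1)[OF s]
  obtain p where i: "0 < i" "i < k" and p: "raising_row (T ! (i - 1)) (T ! i) (T ! Suc i) p"
    and U: "U = T[i := increment p (T ! i)]"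
    using r by (auto simp: raise_def)
  let ?\<beta> = "increment p (T ! i)" and ?y = "next_row (T ! (i - 1)) (increment p (T ! i)) (\<rho> (i - 1))"
  have rows: "\<rho> (Suc j) = next_row (T ! j) (T ! Suc j) (\<rho> j)" if "j < k" for j
    using slide_rowsD(4)[OF s that] by (simp add: next_row_def)
  have "(T ! (i - 1)) (Suc (\<rho> (i - 1))) < (T ! (i - 1)) (\<rho> (i - 1))"
    using i by (intro slide_rows_corner[OF s]) simp
  moreover have "\<rho> i = next_row (T ! (i - 1)) (T ! i) (\<rho> (i - 1))"
    using rows[of "i - 1"] i by simp
  ultimately have z: "next_row ?\<beta> (T ! Suc i) ?y = \<rho> (Suc i)"
    and "\<exists>p'. raising_row (lower (\<rho> (i - 1)) (T ! (i - 1))) (lower (\<rho> i) (T ! i))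
        (lower (\<rho> (Suc i)) (T ! Suc i)) p' \<and> increment p' (lower (\<rho> i) (T ! i)) = lower ?y ?\<beta>"
    using slide_commutes_raising[OF tableau_interlace[OF T i] _ _ rows[OF i(2)] p] by blast+
  then obtain p' where p': "raising_row (S ! (i - 1)) (S ! i) (S ! Suc i) p'"
    and y: "increment p' (S ! i) = lower ?y ?\<beta>"
    using i by (auto simp: slide_rowsD(5)[OF s])
  define V where "V = S[i := lower ?y ?\<beta>]"
  define \<rho>' where "\<rho>' = \<rho>(i := ?y)"
  have len: "length T = Suc k" "length S = Suc k"
    using is_tableauD(1)[OF T] slide_rowsD(2)[OF s] by simp_all
  have "\<rho>' (Suc j) = next_row (U ! j) (U ! Suc j) (\<rho>' j)" if "j < k" for j
  proof -
    consider "i = Suc j" | "j = i" | "Suc j \<noteq> i" "j \<noteq> i" by blast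
    then show ?thesis
    proof cases
      case 1
      then show ?thesis using len that by (simp add: \<rho>'_def U)
    next
      case 2
      then show ?thesis using len i z by (simp add: \<rho>'_def U del: fun_upd_apply) simp
    next
      case 3
      then show ?thesis using that rows by (simp add: \<rho>'_def U)
    qed
  qed
  moreover have "V ! j = lower (\<rho>' j) (U ! j)" if "j \<le> k" for j
    using that len by (simp add: V_def \<rho>'_def U slide_rowsD(5)[OF s])
  ultimately have "slide_rows k U V \<rho>'"
    using raise_tableau[OF T r] slide_rowsD(3)[OF s] i len
    by (auto simp: slide_rows_def next_row_def V_def U \<rho>'_def)
  moreover have "raise k i S V"
    using p' i y by (auto simp: raise_def V_def)
  ultimately show thesis
    using i by (intro that[of V \<rho>']) (simp_all add: \<rho>'_def)
qed

lemma raise_defined_before_slide: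
  assumes s: "slide_rows k T S \<rho>" and r: "raise k i S V"
  obtains U where "raise k i T U"
proof -
  note T = slide_rowsD(1)[OF s]
  obtain p where i: "0 < i" "i < k" and p: "raising_row (S ! (i - 1)) (S ! i) (S ! Suc i) p"
    using r by (auto simp: raise_def)
  have neg: "balance (lower (\<rho> (i - 1)) (T ! (i - 1))) (lower (\<rho> i) (T ! i))
      (lower (\<rho> (Suc i)) (T ! Suc i)) p < 0"
    using p i by (simp add: raising_row_def slide_rowsD(5)[OF s])
  have "(T ! (i - 1)) (Suc (\<rho> (i - 1))) < (T ! (i - 1)) (\<rho> (i - 1))"
    using i by (intro slide_rows_corner[OF s]) simp
  moreover have "\<rho> i = next_row (T ! (i - 1)) (T ! i) (\<rho> (i - 1))"
    using slide_rowsD(4)[OF s, of "i - 1"] i by (simp add: next_row_def)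
  moreover have "\<rho> (Suc i) = next_row (T ! i) (T ! Suc i) (\<rho> i)"
    using slide_rowsD(4)[OF s i(2)] by (simp add: next_row_def)
  ultimately obtain r where "balance (T ! (i - 1)) (T ! i) (T ! Suc i) r < 0"
    using negative_balance_of_lower[OF tableau_interlace[OF T i] _ _ _ neg] by blast
  then obtain q where "raising_row (T ! (i - 1)) (T ! i) (T ! Suc i) q"
    using raising_row_exists[of "T ! (i - 1)" "T ! i" "T ! Suc i" r] is_tableauD(4)[OF T] i by auto
  then show thesis
    using i that by (auto simp: raise_def)
qed

lemma raises_slide:
  assumes "slide_rows k T S \<rho>" "raises k is T U"
  shows "\<exists>V \<rho>'. slide_rows k U V \<rho>' \<and> raises k is S V \<and> \<rho>' 0 = \<rho> 0 \<and> \<rho>' k = \<rho> k"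
  using assms
proof (induction "is" arbitrary: T S \<rho>)
  case (Cons i "is")
  then obtain T1 where T1: "raise k i T T1" "raises k is T1 U" by auto
  obtain S1 \<rho>1 where S1: "slide_rows k T1 S1 \<rho>1" "raise k i S S1" "\<rho>1 0 = \<rho> 0" "\<rho>1 k = \<rho> k"
    using raise_slide[OF Cons.prems(1) T1(1)] .
  show ?case
    using Cons.IH[OF S1(1) T1(2)] S1 by auto
qed auto

text \<open>This carries operators along reverse slides. Once the operator is known to be defined
  before the slide, commutation and uniqueness identify its image with the given tableau.\<close>

lemma raises_before_slide:
  assumes "slide_rows k T S \<rho>" "raises k is S V"
  shows "\<exists>U \<rho>'. slide_rows k U V \<rho>' \<and> raises k is T U \<and> \<rho>' 0 = \<rho> 0 \<and> \<rho>' k = \<rho> k"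
  using assms
proof (induction "is" arbitrary: T S \<rho>)
  case (Cons i "is")
  then obtain S1 where S1: "raise k i S S1" "raises k is S1 V" by auto
  obtain T1 where T1: "raise k i T T1"
    using raise_defined_before_slide[OF Cons.prems(1) S1(1)] .
  obtain S2 \<rho>1 where S2: "slide_rows k T1 S2 \<rho>1" "raise k i S S2" "\<rho>1 0 = \<rho> 0" "\<rho>1 k = \<rho> k"
    using raise_slide[OF Cons.prems(1) T1] .
  have "S2 = S1"
    using raise_unique S1(1) S2(2) by blast
  then show ?case
    using Cons.IH[of T1 S1 \<rho>1] S1 S2 T1 by auto
qed auto

section \<open>Content and highest weight tableaux\<close>

definition part_size :: "part \<Rightarrow> nat" where
  "part_size p = sum p {r. p r \<noteq> 0}"

lemma part_size_eq_sum:
  assumes "finite A" "{r. p r \<noteq> 0} \<subseteq> A"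
  shows "part_size p = sum p A"
  unfolding part_size_def using assms by (intro sum.mono_neutral_left) auto

lemma part_size_upd:
  assumes "is_partition p"
  shows "int (part_size (p(r := x))) = int (part_size p) - int (p r) + int x"
proof -
  let ?A = "insert r {r. p r \<noteq> 0}"
  have fin: "finite ?A"
    using assms by (simp add: is_partition_def)
  have "part_size p = sum p ?A"
    by (rule part_size_eq_sum[OF fin]) auto
  moreover have "part_size (p(r := x)) = sum (p(r := x)) ?A"
    by (rule part_size_eq_sum[OF fin]) auto
  moreover have "sum (p(r := x)) (?A - {r}) = sum p (?A - {r})"
    by (rule sum.cong) auto
  ultimately show ?thesis
    using sum.remove[OF fin, of r p] sum.remove[OF fin, of r "p(r := x)"] by simp
qed

lemma part_size_mono:
  assumes "is_partition p" "is_partition q" "\<And>r. p r \<le> q r"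
  shows "part_size p \<le> part_size q"
proof -
  have supp: "{r. p r \<noteq> 0} \<subseteq> {r. q r \<noteq> 0}"
    using assms(3) by (metis (mono_tags, lifting) Collect_mono le_zero_eq)
  have fin: "finite {r. q r \<noteq> 0}"
    using assms(2) by (simp add: is_partition_def)
  have "part_size p = sum p {r. q r \<noteq> 0}"
    using fin supp by (rule part_size_eq_sum)
  then show ?thesis
    unfolding part_size_def[of q] by (simp add: sum_mono assms(3))
qed

text \<open>The content is cumulative: for \<open>i \<le> k\<close> it counts the entries at most
  \<open>i\<close> of a tableau. Integer values keep the subtraction exact under
  complementation.\<close>

definition content :: "tableau \<Rightarrow> nat \<Rightarrow> int" where
  "content T i = int (part_size (T ! i)) - int (part_size (T ! 0))"

lemma slide_content:
  assumes s: "slide_rows k T S \<rho>" and "i \<le> k"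
  shows "content S i = content T i"
proof -
  note T = slide_rowsD(1)[OF s]
  have "int (part_size (S ! j)) = int (part_size (T ! j)) - 1" if "j \<le> k" for j
    using slide_rows_corner[OF s that] part_size_upd[OF is_tableauD(4)[OF T that], of "\<rho> j"]
    by (simp add: slide_rowsD(5)[OF s that] lower_def)
  then show ?thesis
    using assms(2) by (simp add: content_def)
qed

lemma raise_part_size:
  assumes T: "is_tableau k T" and "raise k i T U"
  shows "part_size (U ! j) = part_size (T ! j) + (if j = i then 1 else 0)"
proof -
  obtain p where i: "0 < i" "i < k" and U: "U = T[i := increment p (T ! i)]"
    using assms(2) by (auto simp: raise_def)
  have "int (part_size (increment p (T ! i))) = int (part_size (T ! i)) + 1"
    using part_size_upd[OF is_tableauD(4)[OF T, of i], of p] i by simp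
  then show ?thesis
    using is_tableauD(1)[OF T] i by (auto simp: U)
qed

lemma raise_content:
  assumes "is_tableau k T" "raise k i T U"
  shows "content U j = content T j + (if j = i then 1 else 0)"
proof -
  have "0 < i" using assms(2) by (simp add: raise_def)
  then show ?thesis
    using raise_part_size[OF assms] by (simp add: content_def)
qed

section \<open>Highest weight tableaux of straight shape\<close>

definition highest :: "nat \<Rightarrow> tableau \<Rightarrow> bool" where
  "highest k T \<longleftrightarrow> (\<nexists>i U. raise k i T U)"

lemma raises_to_highest:
  assumes "is_tableau k T"
  obtains "is" U where "raises k is T U" "highest k U"
proof -
  \<comment> \<open>Each operator adds one box to the total size of the levels, which is bounded
    because the outermost partition never changes.\<close>
  define \<mu> where "\<mu> T = Suc k * part_size (T ! k) - (\<Sum>i\<le>k. part_size (T ! i))" for T :: tableau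
  have bound: "(\<Sum>i\<le>k. part_size (T ! i)) \<le> Suc k * part_size (T ! k)" if "is_tableau k T" for T
    using sum_bounded_above[of "{..k}" "\<lambda>i. part_size (T ! i)" "part_size (T ! k)"]
      part_size_mono[OF is_tableauD(4)[OF that] is_tableauD(4)[OF that] tableau_mono[OF that]]
    by simp
  have "\<exists>is U. raises k is T U \<and> highest k U"
    using assms
  proof (induction "\<mu> T" arbitrary: T rule: less_induct)
    case less
    show ?case
    proof (cases "highest k T")
      case True
      then show ?thesis by (metis raises.simps(1))
    next
      case False
      then obtain i V where V: "raise k i T V" by (auto simp: highest_def)
      note tV = raise_tableau[OF less.prems V]
      have "i \<le> k" using V by (simp add: raise_def)
      then have "(\<Sum>j\<le>k. part_size (V ! j)) = Suc (\<Sum>j\<le>k. part_size (T ! j))"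
        by (simp add: raise_part_size[OF less.prems V] sum.distrib)
      then have "\<mu> V < \<mu> T"
        using bound[OF tV] raise_ends(2)[OF V] by (simp add: \<mu>_def)
      then obtain "is" U where "raises k is V U" "highest k U"
        using less.hyps tV by blast
      then show ?thesis using V by (metis raises.simps(2))
    qed
  qed
  then show thesis using that by blast
qed

lemma straight_tableau_zero:
  assumes T: "is_tableau k T" and "T ! 0 = (\<lambda>_. 0)" "i \<le> k" "i \<le> r"
  shows "(T ! i) r = 0"
  using assms(3,4)
proof (induction i arbitrary: r)
  case (Suc i)
  then obtain r' where "r = Suc r'" "i \<le> r'" by (cases r) auto
  then show ?case
    using Suc is_tableauD(6)[OF T, of i r'] by simp
qed (simp add: assms(2))

lemma highest_balance_nonneg:
  assumes "is_tableau k T" "highest k T" "0 < i" "i < k"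
  shows "0 \<le> balance (T ! (i - 1)) (T ! i) (T ! Suc i) r"
proof (rule ccontr)
  assume "\<not> ?thesis"
  then obtain p where "raising_row (T ! (i - 1)) (T ! i) (T ! Suc i) p"
    using raising_row_exists[of "T ! (i - 1)" "T ! i" "T ! Suc i" r] is_tableauD(4)[OF assms(1)] assms(3,4)
    by auto
  then show False
    using assms(2-4) by (auto simp: highest_def raise_def)
qed

text \<open>This is the Yamanouchi condition: row \<open>r\<close> contains only the entry
  \<open>Suc r\<close>. By induction the rows above contribute nothing to the balance, so its
  nonnegativity in row \<open>r\<close> excludes entries \<open>Suc j\<close> with
  \<open>r < j\<close>.\<close>

lemma highest_straight_rows:
  assumes T: "is_tableau k T" and "T ! 0 = (\<lambda>_. 0)" and h: "highest k T"
    and "i \<le> k" "r < i"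
  shows "(T ! i) r = (T ! k) r"
  using assms(4,5)
proof (induction r arbitrary: i rule: less_induct)
  case (less r)
  have "(T ! j) r = (T ! Suc j) r" if j: "r < j" "j < k" for j
  proof -
    have "(\<Sum>s<r. 2 * int ((T ! j) s) - int ((T ! (j - 1)) s) - int ((T ! Suc j) s)) = 0"
    proof (rule sum.neutral, safe)
      \<comment> \<open>From \<open>s < r < j\<close> it follows that even level
        \<open>j - 1\<close> lies above \<open>s\<close>, so the induction hypothesis covers all
        three levels.\<close>
      fix s assume "s < r"
      then show "2 * int ((T ! j) s) - int ((T ! (j - 1)) s) - int ((T ! Suc j) s) = 0"
        using less.IH[of s j] less.IH[of s "j - 1"] less.IH[of s "Suc j"] j by simp
    qed
    then have "(T ! Suc j) r \<le> (T ! j) r"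
      using highest_balance_nonneg[OF T h, of j r] j by (simp add: balance_def)
    then show ?thesis
      using is_tableauD(5)[OF T j(2), of r] by simp
  qed
  note step = this
  show ?case
    using less.prems by (induction i rule: inc_induct) (auto simp: step)
qed

lemma highest_straight_eqI:
  assumes T: "is_tableau k T" "T ! 0 = (\<lambda>_. 0)" "highest k T"
    and U: "is_tableau k U" "U ! 0 = (\<lambda>_. 0)" "highest k U"
    and "T ! k = U ! k"
  shows "T = U"
proof (rule nth_equalityI)
  show "length T = length U"
    using is_tableauD(1)[OF T(1)] is_tableauD(1)[OF U(1)] by simp
  fix i assume "i < length T"
  then have i: "i \<le> k" using is_tableauD(1)[OF T(1)] by simp
  show "T ! i = U ! i"
  proof
    fix r
    show "(T ! i) r = (U ! i) r"
      using highest_straight_rows[OF T i, of r] highest_straight_rows[OF U i, of r] assms(7)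
        straight_tableau_zero[OF T(1,2) i, of r] straight_tableau_zero[OF U(1,2) i, of r]
      by (cases "r < i") simp_all
  qed
qed

lemma highest_straight_content:
  assumes T: "is_tableau k T" "T ! 0 = (\<lambda>_. 0)" "highest k T" and r: "r < k"
  shows "int ((T ! k) r) = content T (Suc r) - content T r"
proof -
  have eq: "T ! Suc r = (T ! r)(r := (T ! k) r)"
  proof
    fix s
    show "(T ! Suc r) s = ((T ! r)(r := (T ! k) r)) s"
      using highest_straight_rows[OF T, of "Suc r" s] highest_straight_rows[OF T, of r s] r
        straight_tableau_zero[OF T(1,2), of "Suc r" s] straight_tableau_zero[OF T(1,2), of r s]
      by (cases s r rule: linorder_cases) simp_all
  qed
  show ?thesis
    using part_size_upd[OF is_tableauD(4)[OF T(1), of r], of r "(T ! k) r"] r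
      straight_tableau_zero[OF T(1,2), of r r]
    by (simp add: content_def eq)
qed

section \<open>Knuth equivalence\<close>

text \<open>A forward slide starts at the last box of a row of the inner partition. A reverse slide
  starts just beyond a row of the outer partition, since the vacated box is missing from
  \<open>T\<close>.\<close>

lemma jdt_slide_iff_rows:
  "jdt_slide k b T S \<longleftrightarrow>
     (\<exists>\<rho>. slide_rows k T S \<rho> \<and> b = (\<rho> 0, (T ! 0) (\<rho> 0) - 1)) \<or>
     (\<exists>\<rho>. slide_rows k S T \<rho> \<and> b = (\<rho> k, (T ! k) (\<rho> k)))"
proof -
  have "(S ! k) (\<rho> k) - 1 = (T ! k) (\<rho> k)" if "slide_rows k S T \<rho>" for \<rho>
    using slide_rowsD(5)[OF that, of k] by (simp add: lower_apply)
  then show ?thesis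
    unfolding jdt_slide_def slide_into_iff_rows by auto
qed

lemma jdt_slide_tableau: "jdt_slide k b T S \<Longrightarrow> is_tableau k S"
  by (auto simp: jdt_slide_def slide_into_def)

lemma jdt_slides_tableau: "is_tableau k T \<Longrightarrow> jdt_slides k bs T S \<Longrightarrow> is_tableau k S"
  by (induction bs arbitrary: T) (auto dest: jdt_slide_tableau)

lemma knuth_equivalent_iff_rtranclp:
  "knuth_equivalent k T U \<longleftrightarrow> (\<lambda>T S. \<exists>b. jdt_slide k b T S)\<^sup>*\<^sup>* T U"
proof
  assume "knuth_equivalent k T U"
  then obtain bs where "jdt_slides k bs T U" by (auto simp: knuth_equivalent_def)
  then show "(\<lambda>T S. \<exists>b. jdt_slide k b T S)\<^sup>*\<^sup>* T U"
    by (induction bs arbitrary: T) (auto intro: converse_rtranclp_into_rtranclp)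
next
  assume "(\<lambda>T S. \<exists>b. jdt_slide k b T S)\<^sup>*\<^sup>* T U"
  then show "knuth_equivalent k T U"
    unfolding knuth_equivalent_def
  proof (induction rule: converse_rtranclp_induct)
    case base
    then show ?case by (metis jdt_slides.simps(1))
  next
    case (step T S)
    then show ?case by (metis jdt_slides.simps(2))
  qed
qed

lemma knuth_equivalent_trans:
  "knuth_equivalent k T U \<Longrightarrow> knuth_equivalent k U V \<Longrightarrow> knuth_equivalent k T V"
  unfolding knuth_equivalent_iff_rtranclp by (rule rtranclp_trans)

lemma knuth_equivalent_sym:
  assumes "knuth_equivalent k T U"
  shows "knuth_equivalent k U T"
proof -
  have "symp (\<lambda>T S. \<exists>b. jdt_slide k b T S)"
    unfolding symp_def jdt_slide_def by blast
  then show ?thesis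
    using assms unfolding knuth_equivalent_iff_rtranclp by (meson sympD symp_rtranclp)
qed

lemma slide_rows_knuth: "slide_rows k T S \<rho> \<Longrightarrow> knuth_equivalent k T S"
  unfolding knuth_equivalent_iff_rtranclp jdt_slide_iff_rows by (rule r_into_rtranclp) blast

lemma partition_corner:
  assumes "is_partition p" "p \<noteq> (\<lambda>_. 0)"
  obtains r where "p (Suc r) < p r"
proof -
  let ?A = "{r. p r \<noteq> 0}"
  have A: "finite ?A" "?A \<noteq> {}"
    using assms by (auto simp: is_partition_def)
  have "p (Max ?A) \<noteq> 0"
    using Max_in[OF A] by simp
  moreover have "p (Suc (Max ?A)) = 0"
    using Max_ge[OF A(1), of "Suc (Max ?A)"] by auto
  ultimately show thesis using that[of "Max ?A"] by simp
qed

lemma slide_inner_size: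
  assumes s: "slide_rows k T S \<rho>"
  shows "part_size (S ! 0) < part_size (T ! 0)"
  using slide_rowsD(3)[OF s] part_size_upd[OF is_tableauD(4)[OF slide_rowsD(1)[OF s], of 0],
    of "\<rho> 0" "(T ! 0) (\<rho> 0) - 1"]
  by (simp add: slide_rowsD(5)[OF s] lower_def)

lemma rectification_exists:
  assumes "is_tableau k T"
  obtains R where "is_tableau k R" "R ! 0 = (\<lambda>_. 0)" "knuth_equivalent k T R"
proof -
  have "\<exists>R. is_tableau k R \<and> R ! 0 = (\<lambda>_. 0) \<and> knuth_equivalent k T R"
    using assms
  proof (induction "part_size (T ! 0)" arbitrary: T rule: less_induct)
    case less
    show ?case
    proof (cases "T ! 0 = (\<lambda>_. 0)")
      case True
      then show ?thesis
        using less.prems by (auto simp: knuth_equivalent_iff_rtranclp)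
    next
      case False
      obtain r where "(T ! 0) (Suc r) < (T ! 0) r"
        using partition_corner[OF is_tableauD(4)[OF less.prems] False] by auto
      then obtain S \<rho> where s: "slide_rows k T S \<rho>"
        using slide_rows_exists[OF less.prems] by blast
      then show ?thesis
        using less.hyps[OF slide_inner_size[OF s] slide_rows_tableau[OF s]]
          knuth_equivalent_trans[OF slide_rows_knuth[OF s]] by blast
    qed
  qed
  then show thesis using that by blast
qed

section \<open>Knuth equivalence as crystal equivalence\<close>

definition crystal_equivalent :: "nat \<Rightarrow> tableau \<Rightarrow> tableau \<Rightarrow> bool" where
  "crystal_equivalent k T U \<longleftrightarrow> (\<forall>i\<le>k. content T i = content U i) \<and>
     (\<forall>is. (\<exists>V. raises k is T V) \<longleftrightarrow> (\<exists>V. raises k is U V))"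

lemma knuth_imp_crystal_equivalent:
  assumes "knuth_equivalent k T U"
  shows "crystal_equivalent k T U"
proof -
  have slide: "crystal_equivalent k T S" if "slide_rows k T S \<rho>" for T S \<rho>
    unfolding crystal_equivalent_def
    using slide_content[OF that] raises_slide[OF that] raises_before_slide[OF that] by metis
  have sym: "crystal_equivalent k T S \<Longrightarrow> crystal_equivalent k S T" for T S
    by (simp add: crystal_equivalent_def)
  show ?thesis
    using assms unfolding knuth_equivalent_iff_rtranclp
  proof (induction rule: rtranclp_induct)
    case base
    then show ?case by (simp add: crystal_equivalent_def)
  next
    case (step S U)
    then have "crystal_equivalent k S U"
      using slide sym unfolding jdt_slide_iff_rows by blast
    then show ?case
      using step.IH by (simp add: crystal_equivalent_def)
  qed
qed

lemma crystal_equivalent_raises: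
  assumes "crystal_equivalent k T U" "is_tableau k T" "is_tableau k U"
    "raises k is T T'" "raises k is U U'"
  shows "crystal_equivalent k T' U'"
  using assms
proof (induction "is" arbitrary: T U)
  case (Cons i "is")
  obtain T1 where T1: "raise k i T T1" "raises k is T1 T'" using Cons.prems(4) by auto
  obtain U1 where U1: "raise k i U U1" "raises k is U1 U'" using Cons.prems(5) by auto
  have "(\<exists>V. raises k js T1 V) \<longleftrightarrow> (\<exists>V. raises k (i # js) T V)"
    "(\<exists>V. raises k js U1 V) \<longleftrightarrow> (\<exists>V. raises k (i # js) U V)" for js
    using T1(1) U1(1) by (auto dest: raise_unique)
  then have "crystal_equivalent k T1 U1"
    using Cons.prems(1-3) raise_content[OF _ T1(1)] raise_content[OF _ U1(1)]
    unfolding crystal_equivalent_def by metis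
  then show ?case
    using Cons.IH T1 U1 Cons.prems(2,3) raise_tableau by blast
qed simp

lemma crystal_equivalent_highest:
  assumes "crystal_equivalent k T U" "highest k T"
  shows "highest k U"
proof -
  have single: "raises k [i] T V \<longleftrightarrow> raise k i T V" for i T V
    by auto
  have "(\<exists>V. raise k i T V) \<longleftrightarrow> (\<exists>V. raise k i U V)" for i
    using assms(1) unfolding crystal_equivalent_def single[symmetric] by blast
  then show ?thesis
    using assms(2) by (simp add: highest_def)
qed

text \<open>A sequence raising \<open>T\<close> to highest weight is defined on \<open>U\<close> and
  also ends at highest weight. The contents of the two ends agree, so the ends coincide, and
  injectivity of the operators pulls this back to \<open>T = U\<close>.\<close>

lemma crystal_equivalent_straight_eq:
  assumes T: "is_tableau k T" "T ! 0 = (\<lambda>_. 0)" and U: "is_tableau k U" "U ! 0 = (\<lambda>_. 0)"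
    and eq: "crystal_equivalent k T U"
  shows "T = U"
proof -
  obtain "is" T' where T': "raises k is T T'" "highest k T'"
    using raises_to_highest[OF T(1)] .
  obtain U' where U': "raises k is U U'"
    using T'(1) eq by (auto simp: crystal_equivalent_def)
  have eq': "crystal_equivalent k T' U'"
    using crystal_equivalent_raises[OF eq T(1) U(1) T'(1) U'] .
  have hT: "is_tableau k T'" "T' ! 0 = (\<lambda>_. 0)" "highest k T'"
    using raises_tableau[OF T(1) T'(1)] raises_ends[OF T'(1)] T(2) T'(2) by simp_all
  have hU: "is_tableau k U'" "U' ! 0 = (\<lambda>_. 0)" "highest k U'"
    using raises_tableau[OF U(1) U'] raises_ends[OF U'] U(2) crystal_equivalent_highest[OF eq' T'(2)]
    by simp_all
  have "T' ! k = U' ! k"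
  proof
    fix r
    show "(T' ! k) r = (U' ! k) r"
    proof (cases "r < k")
      case True
      have "content T' r = content U' r" "content T' (Suc r) = content U' (Suc r)"
        using eq' True by (simp_all add: crystal_equivalent_def)
      then show ?thesis
        using highest_straight_content[OF hT True] highest_straight_content[OF hU True] by simp
    next
      case False
      then show ?thesis
        using straight_tableau_zero[OF hT(1,2), of k r] straight_tableau_zero[OF hU(1,2), of k r] by simp
    qed
  qed
  then have "T' = U'"
    using highest_straight_eqI[OF hT hU] by blast
  then show ?thesis
    using raises_inject[OF T(1) U(1)] T'(1) U' by blast
qed

lemma knuth_iff_crystal_equivalent:
  assumes "is_tableau k T" "is_tableau k U"
  shows "knuth_equivalent k T U \<longleftrightarrow> crystal_equivalent k T U"
proof
  assume eq: "crystal_equivalent k T U"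
  obtain R where R: "is_tableau k R" "R ! 0 = (\<lambda>_. 0)" "knuth_equivalent k T R"
    using rectification_exists[OF assms(1)] .
  obtain R' where R': "is_tableau k R'" "R' ! 0 = (\<lambda>_. 0)" "knuth_equivalent k U R'"
    using rectification_exists[OF assms(2)] .
  have "crystal_equivalent k R R'"
    using knuth_imp_crystal_equivalent[OF R(3)] knuth_imp_crystal_equivalent[OF R'(3)] eq
    by (simp add: crystal_equivalent_def)
  then have "R = R'"
    using crystal_equivalent_straight_eq R R' by blast
  then show "knuth_equivalent k T U"
    using R(3) R'(3) knuth_equivalent_sym knuth_equivalent_trans by blast
qed (rule knuth_imp_crystal_equivalent)

section \<open>Dual equivalence\<close>

definition joinable :: "nat \<Rightarrow> tableau \<Rightarrow> tableau \<Rightarrow> bool" where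
  "joinable k T U \<longleftrightarrow> (\<exists>is js V. raises k is T V \<and> raises k js U V)"

lemma jdt_slide_unique:
  assumes "jdt_slide k b T S" "jdt_slide k b T S'" "is_tableau k T"
  shows "S = S'"
proof -
  have no_clash: False
    if f: "slide_rows k T S \<rho>" "b = (\<rho> 0, (T ! 0) (\<rho> 0) - 1)"
      and g: "b = (\<rho>' k, (T ! k) (\<rho>' k))" for S \<rho> \<rho>'
    using slide_rowsD(3)[OF f(1)] f(2) g tableau_mono[OF assms(3), of 0 k "\<rho> 0"] by auto
  have fwd: "S = S'" if "slide_rows k T S \<rho>" "b = (\<rho> 0, (T ! 0) (\<rho> 0) - 1)"
    "slide_rows k T S' \<rho>'" "b = (\<rho>' 0, (T ! 0) (\<rho>' 0) - 1)" for S S' \<rho> \<rho>'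
    using slide_rows_unique[OF that(1,3)] that by simp
  have bwd: "S = S'" if "slide_rows k S T \<rho>" "b = (\<rho> k, (T ! k) (\<rho> k))"
    "slide_rows k S' T \<rho>'" "b = (\<rho>' k, (T ! k) (\<rho>' k))" for S S' \<rho> \<rho>'
    using slide_rows_reverse_unique[OF that(1,3)] that by simp
  show ?thesis
    using assms(1,2) no_clash fwd bwd unfolding jdt_slide_iff_rows by blast
qed

lemma jdt_slides_unique:
  assumes "jdt_slides k bs T S" "jdt_slides k bs T S'" "is_tableau k T"
  shows "S = S'"
  using assms
proof (induction bs arbitrary: T)
  case (Cons b bs)
  then show ?case by (metis jdt_slide_tableau jdt_slide_unique jdt_slides.simps(2))
qed simp

text \<open>The start cell is read off the first or last partition and the matching end row of the
  path. Operators preserve both, so the same \<open>b\<close> serves for \<open>U\<close>.\<close>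

lemma raises_jdt_slide:
  assumes "jdt_slide k b T S" "raises k is T U"
  obtains V where "jdt_slide k b U V" "raises k is S V"
proof -
  note ends = raises_ends[OF assms(2)]
  from assms(1) consider
    (fwd) \<rho> where "slide_rows k T S \<rho>" "b = (\<rho> 0, (T ! 0) (\<rho> 0) - 1)"
    | (bwd) \<rho> where "slide_rows k S T \<rho>" "b = (\<rho> k, (T ! k) (\<rho> k))"
    unfolding jdt_slide_iff_rows by blast
  then show thesis
  proof cases
    case fwd
    obtain V \<rho>' where "slide_rows k U V \<rho>'" "raises k is S V" "\<rho>' 0 = \<rho> 0"
      using raises_slide[OF fwd(1) assms(2)] by blast
    then show thesis
      using that[of V] fwd(2) ends unfolding jdt_slide_iff_rows by metis
  next
    case bwd
    obtain V \<rho>' where "slide_rows k V U \<rho>'" "raises k is S V" "\<rho>' k = \<rho> k"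
      using raises_before_slide[OF bwd(1) assms(2)] by blast
    then show thesis
      using that[of V] bwd(2) ends unfolding jdt_slide_iff_rows by metis
  qed
qed

lemma raises_jdt_slides:
  assumes "jdt_slides k bs T S" "raises k is T U"
  shows "\<exists>V. jdt_slides k bs U V \<and> raises k is S V"
  using assms
proof (induction bs arbitrary: T U)
  case (Cons b bs)
  then obtain T1 where T1: "jdt_slide k b T T1" "jdt_slides k bs T1 S" by auto
  obtain U1 where U1: "jdt_slide k b U U1" "raises k is T1 U1"
    using raises_jdt_slide[OF T1(1) Cons.prems(2)] .
  show ?case
    using Cons.IH[OF T1(2) U1(2)] U1(1) by auto
qed simp

text \<open>The same slides applied to the common target have a unique result, and both
  \<open>T'\<close> and \<open>U'\<close> can be raised to it; operators preserve shape.\<close>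

lemma joinable_imp_dual_equivalent:
  assumes T: "is_tableau k T" and U: "is_tableau k U" and "joinable k T U"
  shows "dual_equivalent k T U"
proof -
  obtain "is" js V where V: "raises k is T V" "raises k js U V"
    using assms(3) by (auto simp: joinable_def)
  have "shape T' = shape U'" if slides: "jdt_slides k bs T T'" "jdt_slides k bs U U'" for bs T' U'
  proof -
    obtain V' where V': "jdt_slides k bs V V'" "raises k is T' V'"
      using raises_jdt_slides[OF slides(1) V(1)] by blast
    obtain V'' where V'': "jdt_slides k bs V V''" "raises k js U' V''"
      using raises_jdt_slides[OF slides(2) V(2)] by blast
    have "V' = V''"
      using jdt_slides_unique[OF V'(1) V''(1) raises_tableau[OF T V(1)]] .
    then show ?thesis
      using raises_shape[OF jdt_slides_tableau[OF T slides(1)] V'(2)]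
        raises_shape[OF jdt_slides_tableau[OF U slides(2)] V''(2)] by simp
  qed
  moreover have "shape T = shape U"
    using raises_shape[OF T V(1)] raises_shape[OF U V(2)] by simp
  ultimately show ?thesis
    by (auto simp: dual_equivalent_def)
qed

lemma dual_equivalent_jdt_slide:
  assumes "dual_equivalent k T U" "jdt_slide k b T T'" "jdt_slide k b U U'"
  shows "dual_equivalent k T' U'"
proof -
  have slides: "shape T1 = shape U1" if "jdt_slides k bs T T1" "jdt_slides k bs U U1" for bs T1 U1
    using assms(1) that by (auto simp: dual_equivalent_def)
  have "shape T1 = shape U1" if "jdt_slides k bs T' T1" "jdt_slides k bs U' U1" for bs T1 U1
    using slides[of "b # bs"] that assms(2,3) by auto
  moreover from this[of "[]"] have "shape T' = shape U'" by simp
  ultimately show ?thesis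
    by (auto simp: dual_equivalent_def)
qed

text \<open>At straight shape, both tableaux rise to the one highest weight tableau of their shape.
  Otherwise both slide into the same corner, the results are joinable by induction, and the joining
  operators lift back across the slides.\<close>

lemma dual_equivalent_imp_joinable:
  assumes "is_tableau k T" "is_tableau k U" "dual_equivalent k T U"
  shows "joinable k T U"
  using assms
proof (induction "part_size (T ! 0)" arbitrary: T U rule: less_induct)
  case less
  note T = less.prems(1) and U = less.prems(2)
  have ends: "T ! 0 = U ! 0" "T ! k = U ! k"
    using less.prems(3) by (auto simp: dual_equivalent_def shape_tableau[OF T] shape_tableau[OF U])
  show ?case
  proof (cases "T ! 0 = (\<lambda>_. 0)")
    case True
    obtain "is" V where V: "raises k is T V" "highest k V"
      using raises_to_highest[OF T] .
    obtain js W where W: "raises k js U W" "highest k W"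
      using raises_to_highest[OF U] .
    have "V = W"
    proof (rule highest_straight_eqI)
      show "is_tableau k V" "is_tableau k W"
        using raises_tableau T U V W by blast+
      show "V ! 0 = (\<lambda>_. 0)" "W ! 0 = (\<lambda>_. 0)" "V ! k = W ! k"
        using raises_ends[OF V(1)] raises_ends[OF W(1)] True ends by simp_all
    qed (use V W in auto)
    then show ?thesis
      using V W by (auto simp: joinable_def)
  next
    case False
    obtain r where r: "(T ! 0) (Suc r) < (T ! 0) r"
      using partition_corner[OF is_tableauD(4)[OF T] False] by auto
    obtain T1 \<rho> where T1: "slide_rows k T T1 \<rho>" "\<rho> 0 = r"
      using slide_rows_exists[OF T r] .
    obtain U1 \<sigma> where U1: "slide_rows k U U1 \<sigma>" "\<sigma> 0 = r"
      using slide_rows_exists[OF U r[unfolded ends(1)]] .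
    let ?b = "(r, (T ! 0) r - 1)"
    have "jdt_slide k ?b T T1" "jdt_slide k ?b U U1"
      using T1 U1 ends(1) unfolding jdt_slide_iff_rows by metis+
    then have dual1: "dual_equivalent k T1 U1"
      using dual_equivalent_jdt_slide less.prems(3) by blast
    note tT1 = slide_rows_tableau[OF T1(1)] and tU1 = slide_rows_tableau[OF U1(1)]
    have "joinable k T1 U1"
      using less.hyps[OF slide_inner_size[OF T1(1)] tT1 tU1 dual1] .
    then obtain "is" js V1 where V1: "raises k is T1 V1" "raises k js U1 V1"
      by (auto simp: joinable_def)
    obtain V \<rho>' where V: "slide_rows k V V1 \<rho>'" "raises k is T V" "\<rho>' k = \<rho> k"
      using raises_before_slide[OF T1(1) V1(1)] by blast
    obtain W \<sigma>' where W: "slide_rows k W V1 \<sigma>'" "raises k js U W" "\<sigma>' k = \<sigma> k"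
      using raises_before_slide[OF U1(1) V1(2)] by blast
    \<comment> \<open>Dual equivalence forces both slides to vacate the same cell. The lifted
      tableaux are therefore reverse slides of the single \<open>V1\<close> from one cell, hence
      equal.\<close>
    have "T1 ! k = U1 ! k"
      using dual1 by (simp add: dual_equivalent_def shape_tableau[OF tT1] shape_tableau[OF tU1])
    then have "lower (\<rho> k) (T ! k) = lower (\<sigma> k) (T ! k)"
      using ends(2) by (simp add: slide_rowsD(5)[OF T1(1)] slide_rowsD(5)[OF U1(1)])
    from fun_cong[OF this, of "\<rho> k"] have "\<rho> k = \<sigma> k"
      using slide_rows_corner[OF T1(1), of k] by (auto simp: lower_apply split: if_splits)
    then have "V = W"
      using slide_rows_reverse_unique[OF V(1) W(1)] V(3) W(3) by simp
    then show ?thesis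
      using V W by (auto simp: joinable_def)
  qed
qed

section \<open>Complements\<close>

lemma complement_length: "length (complement k l T) = Suc k"
  by (simp add: complement_def)

lemma complement_nth: "i \<le> k \<Longrightarrow> complement k l T ! i = prepend i l (T ! (k - i))"
  by (simp add: complement_def del: upt_Suc)

lemma prepend_inject: "prepend i l p = prepend i l q \<longleftrightarrow> p = q"
proof
  assume "prepend i l p = prepend i l q"
  then have "p r = q r" for r
    by (auto dest: fun_cong[of _ _ "i + r"] simp: prepend_def)
  then show "p = q" by blast
qed simp

lemma complement_inject:
  assumes "length T = Suc k" "length U = Suc k" "complement k l T = complement k l U"
  shows "T = U"
proof (rule nth_equalityI)
  fix i assume "i < length T"
  then have "i \<le> k" using assms(1) by simp
  then have "complement k l T ! (k - i) = prepend (k - i) l (T ! i)"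
    "complement k l U ! (k - i) = prepend (k - i) l (U ! i)"
    by (simp_all add: complement_nth)
  then show "T ! i = U ! i"
    using assms(3) by (simp add: prepend_inject)
qed (simp add: assms)

lemma prepend_support: "{r. prepend i l p r \<noteq> 0} \<subseteq> {..<i} \<union> (+) i ` {r. p r \<noteq> 0}"
proof
  fix r assume "r \<in> {r. prepend i l p r \<noteq> 0}"
  then show "r \<in> {..<i} \<union> (+) i ` {r. p r \<noteq> 0}"
    by (cases "r < i") (auto simp: prepend_def intro!: image_eqI[of _ _ "r - i"])
qed

lemma is_partition_prepend:
  assumes "is_partition p" "p 0 \<le> l"
  shows "is_partition (prepend i l p)"
proof (rule is_partitionI)
  show "prepend i l p (Suc r) \<le> prepend i l p r" for r
    using partition_Suc_le[OF assms(1), of "r - i"] assms(2)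
    by (cases "Suc r" i rule: linorder_cases) (auto simp: prepend_def Suc_diff_le)
  show "finite {r. prepend i l p r \<noteq> 0}"
    using assms(1) by (intro finite_subset[OF prepend_support]) (simp add: is_partition_def)
qed

lemma part_size_prepend:
  assumes "is_partition p"
  shows "part_size (prepend i l p) = i * l + part_size p"
proof -
  let ?A = "(+) i ` {r. p r \<noteq> 0}"
  have fin: "finite ?A"
    using assms by (simp add: is_partition_def)
  have "part_size (prepend i l p) = sum (prepend i l p) ({..<i} \<union> ?A)"
    using fin prepend_support by (intro part_size_eq_sum) auto
  also have "\<dots> = sum (prepend i l p) {..<i} + sum (prepend i l p) ?A"
    using fin by (intro sum.union_disjoint) auto
  also have "sum (prepend i l p) ?A = part_size p"
    by (simp add: part_size_def sum.reindex prepend_def)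
  finally show ?thesis by (simp add: prepend_def)
qed

text \<open>The extra prepended row interchanges the two interlacing inequalities. The bound
  \<open>l\<close> enters only where the prepended rows meet the old ones.\<close>

lemma complement_tableau:
  assumes T: "is_tableau k T" and l: "\<forall>r. last T r \<le> l"
  shows "is_tableau k (complement k l T)"
proof -
  have le: "(T ! i) r \<le> l" if "i \<le> k" for i r
    using tableau_mono[OF T that, of r] l order_trans by (auto simp: is_tableauD(3)[OF T])
  have il: "interlace (prepend i l (T ! Suc j)) (prepend (Suc i) l (T ! j))" if "j < k" for i j
    unfolding interlace_def
  proof
    fix r
    show "prepend i l (T ! Suc j) r \<le> prepend (Suc i) l (T ! j) r \<and>
      prepend (Suc i) l (T ! j) (Suc r) \<le> prepend i l (T ! Suc j) r"
    proof (cases r i rule: linorder_cases)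
      case greater
      then obtain t where "r = Suc i + t" using less_iff_Suc_add by auto
      then show ?thesis
        using is_tableauD(5,6)[OF T that] by (simp add: prepend_def Suc_diff_le)
    qed (use le[of "Suc j" 0] is_tableauD(5)[OF T that, of 0] that in \<open>auto simp: prepend_def\<close>)
  qed
  have "interlace (complement k l T ! i) (complement k l T ! Suc i)" if "i < k" for i
    using that il[of "k - Suc i" i] by (simp add: complement_nth Suc_diff_Suc)
  moreover have "is_partition (complement k l T ! i)" if "i \<le> k" for i
    using that le[of "k - i" 0] is_tableauD(4)[OF T]
    by (simp add: complement_nth is_partition_prepend)
  ultimately show ?thesis
    by (simp add: is_tableau_iff complement_length)
qed

lemma complement_content:
  assumes T: "is_tableau k T" and "i \<le> k"
  shows "content (complement k l T) i = int (i * l) + content T (k - i) - content T k"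
  using assms is_tableauD(4)[OF T]
  by (simp add: content_def complement_nth part_size_prepend)

text \<open>
  Complementation exchanges the outer two partitions of a two-letter tableau, but it leaves the balance
  unchanged up to the shift of rows; so it commutes with the crystal operators.
\<close>

lemma balance_prepend:
  "balance (prepend j l \<gamma>) (prepend (Suc j) l \<beta>) (prepend (Suc (Suc j)) l \<alpha>) r =
     (if r \<le> j then 0 else balance \<alpha> \<beta> \<gamma> (r - Suc j))"
proof (induction r)
  case 0
  then show ?case by (simp add: balance_0 prepend_def)
next
  case (Suc r)
  consider "r < j" | "r = j" | t where "r = Suc j + t"
    using less_iff_Suc_add by (metis add_Suc linorder_neqE_nat)
  then show ?case
  proof cases
    case 1
    then show ?thesis using Suc by (simp add: balance_Suc prepend_def)
  next
    case 2
    \<comment> \<open>In row \<open>Suc j\<close> the two occurrences of \<open>l\<close> cancel and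
      leave \<open>\<beta> 0 - \<gamma> 0\<close>, the initial balance of the original
      triple.\<close>
    then show ?thesis using Suc by (simp add: balance_Suc balance_0 prepend_def)
  next
    case 3
    then show ?thesis using Suc by (simp add: balance_Suc prepend_def Suc_diff_le)
  qed
qed

text \<open>The first \<open>Suc j\<close> rows have balance 0, so they neither lower the minimum
  nor qualify as raising rows, which need a negative value.\<close>

lemma raising_row_prepend:
  "raising_row (prepend j l \<gamma>) (prepend (Suc j) l \<beta>) (prepend (Suc (Suc j)) l \<alpha>) q \<longleftrightarrow>
     (\<exists>p. q = Suc j + p \<and> raising_row \<alpha> \<beta> \<gamma> p)"
proof
  assume h: "raising_row (prepend j l \<gamma>) (prepend (Suc j) l \<beta>) (prepend (Suc (Suc j)) l \<alpha>) q"
  then have "\<not> q \<le> j"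
    by (auto simp: raising_row_def balance_prepend)
  then obtain p where q: "q = Suc j + p"
    by (metis le_add_diff_inverse not_less_eq_eq)
  have neg: "balance \<alpha> \<beta> \<gamma> p < 0"
    using h by (simp add: raising_row_def balance_prepend q)
  have le: "balance \<alpha> \<beta> \<gamma> p \<le> balance \<alpha> \<beta> \<gamma> r" for r
    using h[unfolded raising_row_def, THEN conjunct2, THEN conjunct1, rule_format, of "Suc j + r"]
    by (simp add: balance_prepend q)
  have less: "balance \<alpha> \<beta> \<gamma> p < balance \<alpha> \<beta> \<gamma> r" if "r < p" for r
    using h[unfolded raising_row_def, THEN conjunct2, THEN conjunct2, rule_format, of "Suc j + r"] that
    by (simp add: balance_prepend q)
  show "\<exists>p. q = Suc j + p \<and> raising_row \<alpha> \<beta> \<gamma> p"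
    using q neg le less by (auto simp: raising_row_def)
next
  assume "\<exists>p. q = Suc j + p \<and> raising_row \<alpha> \<beta> \<gamma> p"
  then obtain p where "q = Suc j + p" "raising_row \<alpha> \<beta> \<gamma> p" by blast
  then show "raising_row (prepend j l \<gamma>) (prepend (Suc j) l \<beta>) (prepend (Suc (Suc j)) l \<alpha>) q"
    by (auto simp: raising_row_def balance_prepend)
qed

lemma prepend_increment: "prepend j l (increment p \<beta>) = increment (j + p) (prepend j l \<beta>)"
  by (auto simp: prepend_def fun_eq_iff)

lemma complement_update:
  assumes "length T = Suc k" "i \<le> k"
  shows "complement k l (T[i := \<beta>]) = (complement k l T)[k - i := prepend (k - i) l \<beta>]"
proof (rule nth_equalityI)
  fix j assume "j < length (complement k l (T[i := \<beta>]))"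
  then have "j \<le> k" by (simp add: complement_length)
  then show "complement k l (T[i := \<beta>]) ! j = (complement k l T)[k - i := prepend (k - i) l \<beta>] ! j"
    using assms by (cases "j = k - i") (auto simp: complement_nth complement_length)
qed (simp add: complement_length)

lemma raise_complement_iff:
  assumes T: "is_tableau k T"
  shows "raise k i (complement k l T) V \<longleftrightarrow> (\<exists>U. raise k (k - i) T U \<and> V = complement k l U)"
proof (cases "0 < i \<and> i < k")
  case False
  then show ?thesis by (auto simp: raise_def)
next
  case True
  then obtain j where j: "i = Suc j" using gr0_implies_Suc by blast
  have levels: "complement k l T ! j = prepend j l (T ! Suc (k - i))"
    "complement k l T ! Suc j = prepend (Suc j) l (T ! (k - i))"
    "complement k l T ! Suc (Suc j) = prepend (Suc (Suc j)) l (T ! (k - i - 1))"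
    using True j by (simp_all add: complement_nth Suc_diff_Suc)
  \<comment> \<open>Level \<open>i\<close> of the complement has \<open>i = Suc j\<close> prepended
    rows, so the box added in row \<open>p\<close> of \<open>T ! (k - i)\<close> appears in row
    \<open>Suc j + p\<close>.\<close>
  have update: "(complement k l T)[i := increment (Suc j + p) (complement k l T ! i)] =
      complement k l (T[k - i := increment p (T ! (k - i))])" for p
    using complement_update[OF is_tableauD(1)[OF T], of "k - i"] True
    by (simp add: j levels prepend_increment)
  have "raise k i (complement k l T) V \<longleftrightarrow>
     (\<exists>p. raising_row (T ! (k - i - 1)) (T ! (k - i)) (T ! Suc (k - i)) p \<and>
        V = (complement k l T)[i := increment (Suc j + p) (complement k l T ! i)])"
    using True by (auto simp: raise_def j levels raising_row_prepend)
  then show ?thesis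
    using True unfolding update by (auto simp: raise_def)
qed

lemma raises_complement_iff:
  assumes "is_tableau k T"
  shows "raises k is (complement k l T) V \<longleftrightarrow>
    (\<exists>U. raises k (map ((-) k) is) T U \<and> V = complement k l U)"
  using assms
proof (induction "is" arbitrary: T)
  case (Cons i "is")
  have "raises k (i # is) (complement k l T) V \<longleftrightarrow>
      (\<exists>T1. raise k (k - i) T T1 \<and> raises k is (complement k l T1) V)"
    by (auto simp: raise_complement_iff[OF Cons.prems])
  also have "\<dots> \<longleftrightarrow> (\<exists>T1. raise k (k - i) T T1 \<and>
      (\<exists>U. raises k (map ((-) k) is) T1 U \<and> V = complement k l U))"
    using Cons.IH raise_tableau[OF Cons.prems] by blast
  finally show ?case by auto
qed auto

text \<open>Truncated subtraction does no harm here: no operator is defined at a level above \<open>k\<close>, nor at \<open>k\<close>.\<close>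

lemma raises_map_diff_diff: "raises k (map ((-) k) (map ((-) k) is)) T U \<longleftrightarrow> raises k is T U"
proof (induction "is" arbitrary: T)
  case (Cons i "is")
  have "raise k (k - (k - i)) T V \<longleftrightarrow> raise k i T V" for V
    by (cases "i \<le> k") (auto simp: raise_def)
  then show ?case using Cons by simp
qed simp

lemma crystal_equivalent_complement:
  assumes T: "is_tableau k T" and U: "is_tableau k U"
  shows "crystal_equivalent k (complement k l T) (complement k l U) \<longleftrightarrow> crystal_equivalent k T U"
proof -
  let ?C = "complement k l"
  have content: "(\<forall>i\<le>k. content (?C T) i = content (?C U) i) \<longleftrightarrow> (\<forall>i\<le>k. content T i = content U i)"
  proof
    assume h: "\<forall>i\<le>k. content (?C T) i = content (?C U) i"
    have "content T 0 = 0" "content U 0 = 0"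
      by (simp_all add: content_def)
    \<comment> \<open>At level \<open>k\<close> the complement has content
      \<open>k * l - content T k\<close>, which determines the total content of \<open>T\<close>;
      the other levels then follow from \<open>k - i\<close>.\<close>
    then have top: "content T k = content U k"
      using h[rule_format, of k] by (simp add: complement_content[OF T] complement_content[OF U])
    show "\<forall>i\<le>k. content T i = content U i"
    proof (intro allI impI)
      fix i assume "i \<le> k"
      then show "content T i = content U i"
        using h[rule_format, of "k - i"] top
        by (simp add: complement_content[OF T] complement_content[OF U])
    qed
  qed (simp add: complement_content[OF T] complement_content[OF U])
  have "(\<exists>V. raises k is (?C T) V) \<longleftrightarrow> (\<exists>V. raises k (map ((-) k) is) T V)"
    "(\<exists>V. raises k is (?C U) V) \<longleftrightarrow> (\<exists>V. raises k (map ((-) k) is) U V)" for "is"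
    by (auto simp: raises_complement_iff[OF T] raises_complement_iff[OF U])
  then have "(\<forall>is. (\<exists>V. raises k is (?C T) V) \<longleftrightarrow> (\<exists>V. raises k is (?C U) V)) \<longleftrightarrow>
      (\<forall>is. (\<exists>V. raises k is T V) \<longleftrightarrow> (\<exists>V. raises k is U V))"
    by (metis raises_map_diff_diff)
  then show ?thesis
    by (simp add: crystal_equivalent_def content)
qed

lemma joinable_complement:
  assumes T: "is_tableau k T" and U: "is_tableau k U"
  shows "joinable k (complement k l T) (complement k l U) \<longleftrightarrow> joinable k T U"
proof
  assume "joinable k (complement k l T) (complement k l U)"
  then obtain "is" js V W where V: "raises k (map ((-) k) is) T V"
    and W: "raises k (map ((-) k) js) U W" and eq: "complement k l V = complement k l W"
    by (auto simp: joinable_def raises_complement_iff[OF T] raises_complement_iff[OF U])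
  \<comment> \<open>Only the complements of the two targets are known to agree; complementation is
    injective on lists of length \<open>Suc k\<close>.\<close>
  have "V = W"
    using complement_inject[OF _ _ eq] is_tableauD(1) raises_tableau[OF T V] raises_tableau[OF U W] by blast
  then show "joinable k T U"
    using V W by (auto simp: joinable_def)
next
  assume "joinable k T U"
  then obtain "is" js V where "raises k is T V" "raises k js U V"
    by (auto simp: joinable_def)
  then have "raises k (map ((-) k) is) (complement k l T) (complement k l V)"
    "raises k (map ((-) k) js) (complement k l U) (complement k l V)"
    unfolding raises_complement_iff[OF T] raises_complement_iff[OF U] raises_map_diff_diff by blast+
  then show "joinable k (complement k l T) (complement k l U)"
    by (auto simp: joinable_def)
qed

theorem theorem2p2:
  fixes k l :: nat and T U :: tableau
  assumes "k \<ge> 1" and "l \<ge> 1"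
    and "is_tableau k T" and "\<forall>r. last T r \<le> l"
    and "is_tableau k U" and "\<forall>r. last U r \<le> l"
  shows "(knuth_equivalent k U T \<longleftrightarrow>
            knuth_equivalent k (complement k l U) (complement k l T)) \<and>
         (dual_equivalent k U T \<longleftrightarrow>
            dual_equivalent k (complement k l U) (complement k l T))"
proof -
  note T = assms(3) and U = assms(5)
  note CT = complement_tableau[OF assms(3,4)] and CU = complement_tableau[OF assms(5,6)]
  have dual_iff: "dual_equivalent k V W \<longleftrightarrow> joinable k V W"
    if "is_tableau k V" "is_tableau k W" for V W
    using that joinable_imp_dual_equivalent dual_equivalent_imp_joinable by blast
  show ?thesis
    using knuth_iff_crystal_equivalent[OF U T] knuth_iff_crystal_equivalent[OF CU CT]
      crystal_equivalent_complement[OF U T] dual_iff[OF U T] dual_iff[OF CU CT]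
      joinable_complement[OF U T] by blast
qed

end
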